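(* Let $A\in\mathbb{H}^n_{\sup}$ and $B\in\mathbb{H}^{n\times m}_{\sup}$, and suppose the following three assumptions hold. (I) For all $c\in\mathcal{M}$ and $\delta>0$, $\mu(\{\phi\in\mathcal{M}:\|\phi-c\|<\delta\})>0$. (II) The functions $A$ and $B$ are continuous on $\mathcal{M}$. (III) There exist $S\in\mathbb{H}^{n+}_{\sup}$, $F\in\mathbb{H}^{m\times n}_{\sup}$ and $\epsilon>0$ such that $$S(\phi)-(A(\phi)+B(\phi)F(\phi))^{\top}\left(\int_{\mathcal{M}}g(\phi,\ell)S(\ell)\mu(d\ell)\right)(A(\phi)+B(\phi)F(\phi))\ge\epsilon I$$ for $\mu$-almost every $\phi\in\mathcal{M}$. Moreover, for every $\epsilon_a,\epsilon_b>0$ there exist disjoint boxes $\{\mathcal{B}_i\}_{i=1}^N$ whose union is $\mathcal{M}$, points $c_i\in\mathcal{B}_i$ $(i=1,\dots,N)$, and piecewise-constant functions $S_a\in\mathbb{H}^{n+}_{\sup}$, $F_a\in\mathbb{H}^{m\times n}_{\sup}$, with $S_a(\phi)=S_i>0$ and $F_a(\phi)=F_i$ for all $\phi\in\mathcal{B}_i$, such that: 1. $\|S-S_a\|_\infty<\epsilon_a$ and $\|F-F_a\|_\infty<\epsilon_a$; 2. for all $i,j=1,\dots,N$, the function $w_j(\phi):=\int_{\mathcal{B}_j}g(\phi,\ell)\mu(d\ell)$ is continuous at $\phi=c_i$; 3. for every $i=1,\dots,N$ and $\mu$-almost every $\phi\in\mathcal{B}_i$, $$\left\|\begin{bmatrix}A(\phi)&B(\phi)\end{bmatrix}-\begin{bmatrix}A(c_i)&B(c_i)\end{bmatrix}\right\|<\epsilon_b,$$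 $$\left\|\begin{bmatrix}\sqrt{w_1(\phi)}&\cdots&\sqrt{w_N(\phi)}\end{bmatrix}-\begin{bmatrix}\sqrt{w_1(c_i)}&\cdots&\sqrt{w_N(c_i)}\end{bmatrix}\right\|<\epsilon_b.$$ Then there exist disjoint boxes $\{\mathcal{B}_i\}_{i=1}^N$ whose union is $\mathcal{M}$, points $c_i\in\mathcal{B}_i$ and scalars $\kappa_i>0$ $(i=1,\dots,N)$ such that, with $w_j(\phi):=\int_{\mathcal{B}_j}g(\phi,\ell)\mu(d\ell)$ and $$\begin{bmatrix}\Gamma_{A,i}&\Gamma_{B,i}\end{bmatrix}:=\begin{bmatrix}\sqrt{w_1(c_i)}A(c_i)&\sqrt{w_1(c_i)}B(c_i)\\ \vdots&\vdots\\ \sqrt{w_N(c_i)}A(c_i)&\sqrt{w_N(c_i)}B(c_i)\end{bmatrix},$$ one has $$\left\|\begin{bmatrix}\sqrt{w_1(\phi)}A(\phi)&\sqrt{w_1(\phi)}B(\phi)\\ \vdots&\vdots\\ \sqrt{w_N(\phi)}A(\phi)&\sqrt{w_N(\phi)}B(\phi)\end{bmatrix}-\begin{bmatrix}\Gamma_{A,i}&\Gamma_{B,i}\end{bmatrix}\right\|\le\kappa_i\quad\text{for $\mu$-almost every }\phi\in\mathcal{B}_i,\ i=1,\dots,N,$$ and the linear matrix inequalities $$\begin{bmatrix}U_i+U_i^{\top}-R_i&0&U_i^{\top}\Gamma_{A,i}^{\top}+\bar F_i^{\top}\Gamma_{B,i}^{\top}&\kappa_i\begin{bmatrix}U_i^{\top}&\bar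 F_i^{\top}\end{bmatrix}\\ \star&\lambda_iI&\lambda_iI&0\\ \star&\star&\bm{R}&0\\ \star&\star&\star&\lambda_iI\end{bmatrix}>0,\qquad i=1,\dots,N,\quad \bm{R}:=\mathrm{diag}(R_1,\dots,R_N),$$ are feasible, i.e. are satisfied by some positive definite $R_i\in\mathbb{R}^{n\times n}$, matrices $U_i\in\mathbb{R}^{n\times n}$, $\bar F_i\in\mathbb{R}^{m\times n}$, and scalars $\lambda_i>0$.
   Context: $\mathcal{M}=[\tau_{\min},\tau_{\max}]^p\subset\mathbb{R}^p$, with its Borel $\sigma$-algebra and a $\sigma$-finite measure $\mu$. $g(\cdot,\cdot)$ is the transition density with respect to $\mu$ of a time-homogeneous Markov chain $\{\phi_k\}$ in $\mathcal{M}$: $P(\phi_{k+1}\in\mathcal{B}\mid\phi_k=\phi)=\int_{\mathcal{B}}g(\phi,\ell)\mu(d\ell)$ for all Borel $\mathcal{B}\subset\mathcal{M}$; in particular $\int_{\mathcal{M}}g(\phi,\ell)\mu(d\ell)=1$. A box is a product of $p$ intervals. $\mathbb{H}^{n\times m}_{\sup}$ is the space of measurable, essentially bounded functions $\mathcal{M}\to\mathbb{R}^{n\times m}$; $\mathbb{H}^n_{\sup}:=\mathbb{H}^{n\times n}_{\sup}$; $\mathbb{H}^{n+}_{\sup}$ is the set of $P\in\mathbb{H}^n_{\sup}$ with $P(\phi)\ge0$ (symmetric positive semidefinite) for $\mu$-almost every $\phi$. $\|P\|_\infty$ is the $\mu$-essential supremum of $\|P(\cdot)\|$, where $\|\cdot\|$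 is the Euclidean norm for vectors and the induced norm for matrices. $\star$ denotes blocks determined by symmetry; $>0$ means symmetric positive definite. Block sizes in the inequality are $n,nN,nN,n+m$. *)

theory Defs
  imports "HOL-Probability.Probability"
begin

text \<open>An \<open>n \<times> m\<close> real matrix has type \<open>real^'m^'n\<close> (columns first).  The type class norm on that
  type is not the induced norm, which is written \<open>mnorm\<close> below.\<close>

definition mnorm :: "real^'m^'n \<Rightarrow> real"
  where "mnorm X = onorm ((*v) X)"

definition psd :: "real^'n^'n \<Rightarrow> bool"
  where "psd X \<longleftrightarrow> transpose X = X \<and> (\<forall>x. 0 \<le> x \<bullet> (X *v x))"

definition posdef :: "real^'n^'n \<Rightarrow> bool"
  where "posdef X \<longleftrightarrow> transpose X = X \<and> (\<forall>x. x \<noteq> 0 \<longrightarrow> 0 < x \<bullet> (X *v x))"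

definition hcat :: "real^'a^'r \<Rightarrow> real^'b^'r \<Rightarrow> real^('a + 'b)^'r"
  where "hcat X Y = (\<chi> r k. case k of Inl a \<Rightarrow> X $ r $ a | Inr b \<Rightarrow> Y $ r $ b)"

text \<open>Induced norm of the matrix obtained by stacking \<open>X 0, \<dots>, X (N - 1)\<close>.  The number of blocks is
  not a type, so the supremum defining \<^const>\<open>onorm\<close> is written out, with the Euclidean norm of the
  stacked image vector as an \<^const>\<open>L2_set\<close>.\<close>

definition stacked_mnorm :: "nat \<Rightarrow> (nat \<Rightarrow> real^'c^'r) \<Rightarrow> real"
  where "stacked_mnorm N X = (SUP x. L2_set (\<lambda>j. norm (X j *v x)) {..<N} / norm x)"

definition param_space :: "real \<Rightarrow> real \<Rightarrow> (real^'p) set"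
  where "param_space \<tau>min \<tau>max = {\<phi>. \<forall>k. \<phi> $ k \<in> {\<tau>min..\<tau>max}}"

definition is_box :: "(real^'p) set \<Rightarrow> bool"
  where "is_box S \<longleftrightarrow> (\<exists>J :: 'p \<Rightarrow> real set. (\<forall>k. is_interval (J k)) \<and> S = {\<phi>. \<forall>k. \<phi> $ k \<in> J k})"

definition box_partition :: "(real^'p) set \<Rightarrow> nat \<Rightarrow> (nat \<Rightarrow> (real^'p) set) \<Rightarrow> bool"
  where "box_partition M N \<B> \<longleftrightarrow>
    (\<forall>i<N. is_box (\<B> i)) \<and> disjoint_family_on \<B> {..<N} \<and> (\<Union>i<N. \<B> i) = M"

definition sup_norm :: "'a measure \<Rightarrow> ('a \<Rightarrow> real^'m^'n) \<Rightarrow> ereal"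
  where "sup_norm \<mu> P = esssup \<mu> (\<lambda>\<phi>. ereal (mnorm (P \<phi>)))"

definition Hsup :: "'a measure \<Rightarrow> ('a \<Rightarrow> real^'m^'n) set"
  where "Hsup \<mu> = {P. P \<in> borel_measurable \<mu> \<and> sup_norm \<mu> P < \<infinity>}"

definition Hsup_plus :: "'a measure \<Rightarrow> ('a \<Rightarrow> real^'n^'n) set"
  where "Hsup_plus \<mu> = {P \<in> Hsup \<mu>. AE \<phi> in \<mu>. psd (P \<phi>)}"

text \<open>\<open>g\<close> is a transition density: \<open>\<phi> \<mapsto> g(\<phi>, y) \<mu>(dy)\<close> is a Markov kernel.  In particular every
  \<open>g(\<phi>, \<cdot>)\<close> has integral 1.  Joint measurability of \<open>g\<close> is not required.\<close>

definition transition_density :: "'a measure \<Rightarrow> ('a \<Rightarrow> 'a \<Rightarrow> real) \<Rightarrow> bool"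
  where "transition_density \<mu> g \<longleftrightarrow>
    (\<forall>\<phi>\<in>space \<mu>. g \<phi> \<in> borel_measurable \<mu> \<and> (\<forall>y\<in>space \<mu>. 0 \<le> g \<phi> y)) \<and>
    (\<lambda>\<phi>. density \<mu> (\<lambda>y. ennreal (g \<phi> y))) \<in> \<mu> \<rightarrow>\<^sub>M prob_algebra \<mu>"

definition box_prob ::
    "'a measure \<Rightarrow> ('a \<Rightarrow> 'a \<Rightarrow> real) \<Rightarrow> (nat \<Rightarrow> 'a set) \<Rightarrow> nat \<Rightarrow> 'a \<Rightarrow> real"
  where "box_prob \<mu> g \<B> j \<phi> = (LINT y:\<B> j|\<mu>. g \<phi> y)"

text \<open>Matrices whose size depends on the number \<open>N\<close> of boxes are functions on a finite index set.\<close>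

definition posdef_on :: "'i set \<Rightarrow> ('i \<Rightarrow> 'i \<Rightarrow> real) \<Rightarrow> bool"
  where "posdef_on I X \<longleftrightarrow>
    (\<forall>p\<in>I. \<forall>q\<in>I. X p q = X q p) \<and>
    (\<forall>x. (\<exists>p\<in>I. x p \<noteq> 0) \<longrightarrow> 0 < (\<Sum>p\<in>I. \<Sum>q\<in>I. x p * X p q * x q))"

text \<open>Row and column indices of the linear matrix inequality: one constructor for each of the four
  block rows, of sizes \<open>n\<close>, \<open>n N\<close>, \<open>n N\<close>, \<open>n + m\<close>.\<close>

datatype ('n, 'm) lmi_index = Ix1 'n | Ix2 nat 'n | Ix3 nat 'n | Ix4 "'n + 'm"

definition lmi_indices :: "nat \<Rightarrow> ('n, 'm) lmi_index set"
  where "lmi_indices N =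
    range Ix1 \<union> {Ix2 j a | j a. j < N} \<union> {Ix3 j a | j a. j < N} \<union> range Ix4"

text \<open>\<open>\<Gamma>A j\<close> and \<open>\<Gamma>B j\<close> are the \<open>j\<close>-th blocks of \<open>\<Gamma>\<^bsub>A,i\<^esub>\<close> and \<open>\<Gamma>\<^bsub>B,i\<^esub>\<close>; \<open>R\<close> is the whole family
  \<open>R\<^sub>1, \<dots>, R\<^sub>N\<close>, while \<open>\<kappa>\<close>, \<open>U\<close>, \<open>Fb\<close> and \<open>l\<close> stand for
  \<open>\<kappa>\<^sub>i\<close>, \<open>U\<^sub>i\<close>, the barred \<open>F\<^sub>i\<close> and \<open>\<lambda>\<^sub>i\<close>.  The last six equations
  are the transposes of the off-diagonal blocks above them.\<close>

fun lmi_matrix ::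
  "nat \<Rightarrow> (nat \<Rightarrow> real^'n^'n) \<Rightarrow> (nat \<Rightarrow> real^'m^'n) \<Rightarrow> real \<Rightarrow>
   (nat \<Rightarrow> real^'n^'n) \<Rightarrow> real^'n^'n \<Rightarrow> real^'n^'m \<Rightarrow> real \<Rightarrow>
   ('n, 'm) lmi_index \<Rightarrow> ('n, 'm) lmi_index \<Rightarrow> real"
where
  "lmi_matrix i \<Gamma>A \<Gamma>B \<kappa> R U Fb l (Ix1 a) (Ix1 b) = (U + transpose U - R i) $ a $ b"
| "lmi_matrix i \<Gamma>A \<Gamma>B \<kappa> R U Fb l (Ix1 a) (Ix2 k b) = 0"
| "lmi_matrix i \<Gamma>A \<Gamma>B \<kappa> R U Fb l (Ix1 a) (Ix3 k b) =
    (transpose U ** transpose (\<Gamma>A k) + transpose Fb ** transpose (\<Gamma>B k)) $ a $ b"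
| "lmi_matrix i \<Gamma>A \<Gamma>B \<kappa> R U Fb l (Ix1 a) (Ix4 b) =
    (\<kappa> *\<^sub>R hcat (transpose U) (transpose Fb)) $ a $ b"
| "lmi_matrix i \<Gamma>A \<Gamma>B \<kappa> R U Fb l (Ix2 j a) (Ix2 k b) = (if j = k \<and> a = b then l else 0)"
| "lmi_matrix i \<Gamma>A \<Gamma>B \<kappa> R U Fb l (Ix2 j a) (Ix3 k b) = (if j = k \<and> a = b then l else 0)"
| "lmi_matrix i \<Gamma>A \<Gamma>B \<kappa> R U Fb l (Ix2 j a) (Ix4 b) = 0"
| "lmi_matrix i \<Gamma>A \<Gamma>B \<kappa> R U Fb l (Ix3 j a) (Ix3 k b) = (if j = k then R j $ a $ b else 0)"
| "lmi_matrix i \<Gamma>A \<Gamma>B \<kappa> R U Fb l (Ix3 j a) (Ix4 b) = 0"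
| "lmi_matrix i \<Gamma>A \<Gamma>B \<kappa> R U Fb l (Ix4 a) (Ix4 b) = (if a = b then l else 0)"
| "lmi_matrix i \<Gamma>A \<Gamma>B \<kappa> R U Fb l (Ix2 j a) (Ix1 b) = 0"
| "lmi_matrix i \<Gamma>A \<Gamma>B \<kappa> R U Fb l (Ix3 j a) (Ix1 b) =
    (transpose U ** transpose (\<Gamma>A j) + transpose Fb ** transpose (\<Gamma>B j)) $ b $ a"
| "lmi_matrix i \<Gamma>A \<Gamma>B \<kappa> R U Fb l (Ix4 a) (Ix1 b) =
    (\<kappa> *\<^sub>R hcat (transpose U) (transpose Fb)) $ b $ a"
| "lmi_matrix i \<Gamma>A \<Gamma>B \<kappa> R U Fb l (Ix3 j a) (Ix2 k b) = (if j = k \<and> a = b then l else 0)"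
| "lmi_matrix i \<Gamma>A \<Gamma>B \<kappa> R U Fb l (Ix4 a) (Ix2 k b) = 0"
| "lmi_matrix i \<Gamma>A \<Gamma>B \<kappa> R U Fb l (Ix4 a) (Ix3 k b) = 0"

end

theory Submission
  imports Defs
begin

text \<open>
  The idea is to freeze the strict Riccati inequality of the hypothesis on the boxes of a fine
  partition, and to observe that a Riccati inequality with a positive margin implies the linear matrix
  inequality by elimination of variables.

  For the second step (\<open>riccati_imp_lmi\<close>) take \<open>R\<^sub>i = U\<^sub>i = S\<^sub>i\<^sup>-\<^sup>1\<close> and the gain \<open>F\<^sub>i S\<^sub>i\<^sup>-\<^sup>1\<close>.  Completing
  squares in the quadratic form of the large matrix leaves
  \<open>y \<bullet> S\<^sub>i y - \<Sum>\<^sub>j w\<^sub>j(c\<^sub>i) (K\<^sub>i y) \<bullet> S\<^sub>j (K\<^sub>i y)\<close> with \<open>K\<^sub>i = A(c\<^sub>i) + B(c\<^sub>i) F\<^sub>i\<close>, up to errors which are small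
  when \<open>\<lambda>\<close> is small and \<open>\<kappa>\<^sup>2\<close> is small compared with \<open>\<lambda>\<close>.  So \<open>\<lambda>\<close> is fixed from a bound \<open>s\<close> on
  the \<open>S\<^sub>j\<close> and from the margin, and the partition is then chosen so fine that \<open>\<kappa>\<close>, which
  is proportional to \<open>\<epsilon>\<^sub>b\<close> (\<open>stacked_mnorm_weighted_le\<close>), is small enough.

  For the first step, consider a box of positive measure.  It contains a point \<open>\<phi>\<close> at which the Riccati
  inequality holds and at which all data are close to the frozen data of the box, because each of
  these properties holds almost everywhere in the box.  Comparison of the two inequalities
  (\<open>riccati_perturbation\<close>) costs at most half of the margin.  The integral of \<open>g S\<close> is compared
  with that of the step function in \<open>expectation_ge_step_function\<close>, and the transition probabilities
  from \<open>\<phi>\<close> and from the centre are compared through their square roots in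
  \<open>sum_abs_diff_le_L2_sqrt\<close>.

  Boxes of measure zero need separate care: the hypotheses hold only almost everywhere, so
  they leave \<open>S\<^sub>i\<close> and \<open>F\<^sub>i\<close> uncontrolled there.  But no transition leads into such a box, so its \<open>S\<^sub>i\<close>
  does not enter the sum above for any box.  One may therefore take \<open>S\<^sub>i = L I\<close> and \<open>F\<^sub>i = 0\<close> with \<open>L\<close> large;
  how large is determined by the bound of \<open>A\<close> on the compact set \<open>M\<close> and the essential bound of \<open>S\<close>.
\<close>

section \<open>Norms and quadratic forms of matrices\<close>

lemma norm_le_mnorm: "norm (X *v v) \<le> mnorm X * norm v"
  unfolding mnorm_def by (rule onorm) simp

lemma quadratic_form_le:
  fixes X :: "real^'n^'n"
  assumes "norm (X *v v) \<le> r * norm v"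
  shows "v \<bullet> (X *v v) \<le> r * (norm v)\<^sup>2"
proof -
  have "v \<bullet> (X *v v) \<le> norm v * norm (X *v v)" by (rule norm_cauchy_schwarz)
  also have "\<dots> \<le> norm v * (r * norm v)" by (intro mult_left_mono assms) simp
  finally show ?thesis by (simp add: power2_eq_square mult_ac)
qed

text \<open>The norm on the right is that of the type class, which on matrices is the Frobenius norm.
  Continuity and boundedness refer to it, so this bridges to the induced norm.\<close>

lemma norm_matrix_vector_le: "norm (X *v v) \<le> norm X * norm v" for X :: "real^'m^'n"
proof -
  have "norm (X *v v) \<le> L2_set (\<lambda>i. norm (X $ i) * norm v) UNIV"
    unfolding norm_vec_def[of "X *v v"]
  proof (rule L2_set_mono)
    fix i
    have "(X *v v) $ i = X $ i \<bullet> v"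
      by (simp add: matrix_vector_mult_def inner_vec_def)
    then show "norm ((X *v v) $ i) \<le> norm (X $ i) * norm v"
      by (simp add: Cauchy_Schwarz_ineq2)
  qed simp
  also have "\<dots> = norm X * norm v"
    by (simp add: norm_vec_def[of X] L2_set_left_distrib)
  finally show ?thesis .
qed

text \<open>All norms on matrices are equivalent; this direction turns an essential bound on the induced
  norm into integrability.\<close>

lemma norm_le_card_mnorm:
  "norm X \<le> real (CARD('n) * CARD('m)) * mnorm X" for X :: "real^'m^'n"
proof -
  have entry: "\<bar>X $ i $ j\<bar> \<le> mnorm X" for i j
  proof -
    have "\<bar>X $ i $ j\<bar> = \<bar>(X *v axis j 1) $ i\<bar>"
      by (simp add: matrix_vector_mult_basis column_def)
    also have "\<dots> \<le> norm (X *v axis j 1)" by (rule component_le_norm_cart)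
    also have "\<dots> \<le> mnorm X" using norm_le_mnorm[of X "axis j 1"] by simp
    finally show ?thesis .
  qed
  have "norm X \<le> (\<Sum>i\<in>UNIV. norm (X $ i))"
    unfolding norm_vec_def by (rule L2_set_le_sum) simp
  also have "\<dots> \<le> (\<Sum>i\<in>(UNIV :: 'n set). \<Sum>j\<in>(UNIV :: 'm set). \<bar>X $ i $ j\<bar>)"
    by (intro sum_mono norm_le_l1_cart)
  also have "\<dots> \<le> (\<Sum>i\<in>(UNIV :: 'n set). \<Sum>j\<in>(UNIV :: 'm set). mnorm X)"
    by (intro sum_mono entry)
  finally show ?thesis by simp
qed

lemma inner_transpose_mult: "x \<bullet> (transpose X *v y) = (X *v x) \<bullet> y" for X :: "real^'m^'n"
  using dot_lmul_matrix[of y X x] by (simp add: inner_commute)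

lemma symmetric_form_commute: "transpose X = X \<Longrightarrow> x \<bullet> (X *v y) = y \<bullet> (X *v x)"
  for X :: "real^'n^'n"
  using inner_transpose_mult[of x X y] by (simp only: inner_commute)

lemma quadratic_form_add:
  fixes X :: "real^'n^'n"
  assumes "transpose X = X"
  shows "(x + y) \<bullet> (X *v (x + y)) = x \<bullet> (X *v x) + 2 * (x \<bullet> (X *v y)) + y \<bullet> (X *v y)"
  using symmetric_form_commute[OF assms, of x y]
  by (simp add: matrix_vector_right_distrib inner_add_left inner_add_right)

lemma posdef_nonneg: "posdef X \<Longrightarrow> 0 \<le> x \<bullet> (X *v x)"
  by (cases "x = 0") (auto simp: posdef_def less_imp_le)

section \<open>Inverses of positive definite matrices\<close>

lemma posdef_inverse:
  fixes S :: "real^'n^'n"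
  assumes "posdef S"
  shows posdef_mult_inv: "S *v (matrix_inv S *v x) = x"
    and posdef_matrix_inv: "posdef (matrix_inv S)"
proof -
  have "S *v x = 0 \<Longrightarrow> x = 0" for x
    using assms by (auto simp: posdef_def)
  then have "invertible S"
    by (simp add: invertible_left_inverse matrix_left_invertible_ker)
  then have inv: "S ** matrix_inv S = mat 1" "matrix_inv S ** S = mat 1"
    unfolding invertible_def matrix_inv_def by (rule someI2_ex; blast)+
  show 1: "S *v (matrix_inv S *v x) = x" for x
    by (simp add: matrix_vector_mul_assoc inv)
  have S: "transpose S = S" using assms by (simp add: posdef_def)
  have "transpose (matrix_inv S) ** S = mat 1"
    by (metis S inv(1) matrix_transpose_mul transpose_mat)
  then have "transpose (matrix_inv S) = matrix_inv S"
    by (metis inv(1) matrix_mul_assoc matrix_mul_lid matrix_mul_rid)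
  moreover have "0 < x \<bullet> (matrix_inv S *v x)" if "x \<noteq> 0" for x
  proof -
    have "matrix_inv S *v x \<noteq> 0" using 1[of x] that by auto
    then have "0 < (matrix_inv S *v x) \<bullet> (S *v (matrix_inv S *v x))"
      using assms unfolding posdef_def by blast
    then show ?thesis by (simp add: 1 inner_commute)
  qed
  ultimately show "posdef (matrix_inv S)" by (simp add: posdef_def)
qed

text \<open>Completing the square: with \<open>u = S\<^sup>-\<^sup>1 x\<close> the left-hand side is \<open>(u + v) \<bullet> S (u + v)\<close>.\<close>

lemma Young_matrix_inv:
  fixes S :: "real^'n^'n"
  assumes "posdef S"
  shows "0 \<le> x \<bullet> (matrix_inv S *v x) + 2 * (v \<bullet> x) + v \<bullet> (S *v v)"
proof -
  define u where "u = matrix_inv S *v x"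
  have x: "S *v u = x" unfolding u_def by (rule posdef_mult_inv[OF assms])
  have "0 \<le> (u + v) \<bullet> (S *v (u + v))" by (rule posdef_nonneg[OF assms])
  also have "\<dots> = u \<bullet> (S *v u) + 2 * (v \<bullet> (S *v u)) + v \<bullet> (S *v v)"
    using quadratic_form_add[of S u v] symmetric_form_commute[of S u v] assms
    by (simp add: posdef_def)
  finally show ?thesis unfolding x by (simp add: u_def inner_commute)
qed

text \<open>Inversion reverses the order of positive definite matrices.  In Young's inequality, the choice
  \<open>v = - x / s\<close> minimises the expression after \<open>S\<close> has been replaced by \<open>s I\<close>.\<close>

lemma matrix_inv_form_ge:
  fixes S :: "real^'n^'n"
  assumes "posdef S" and le: "\<And>v. v \<bullet> (S *v v) \<le> s * (norm v)\<^sup>2" and "s > 0"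
  shows "(norm x)\<^sup>2 / s \<le> x \<bullet> (matrix_inv S *v x)"
proof -
  define v where "v = (- 1 / s) *\<^sub>R x"
  have "v \<bullet> (S *v v) \<le> s * (norm v)\<^sup>2" by (rule le)
  also have "\<dots> = (norm x)\<^sup>2 / s"
    using \<open>s > 0\<close> by (simp add: v_def power_mult_distrib power2_eq_square field_simps)
  finally have "v \<bullet> (S *v v) \<le> (norm x)\<^sup>2 / s" .
  moreover have "v \<bullet> x = - ((norm x)\<^sup>2 / s)"
    by (simp add: v_def power2_norm_eq_inner)
  ultimately show ?thesis
    using Young_matrix_inv[OF assms(1), of x v] by simp
qed

section \<open>Stacked vectors and block matrices\<close>

definition vcat :: "real^'a \<Rightarrow> real^'b \<Rightarrow> real^('a + 'b)"
  where "vcat y z = (\<chi> k. case k of Inl a \<Rightarrow> y $ a | Inr b \<Rightarrow> z $ b)"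

lemma sum_UNIV_sum:
  "(\<Sum>k\<in>UNIV. f k) = (\<Sum>a\<in>UNIV. f (Inl a)) + (\<Sum>b\<in>UNIV. f (Inr b))"
  for f :: "'a::finite + 'b::finite \<Rightarrow> 'c::comm_monoid_add"
  using sum.Plus[of UNIV UNIV f] by simp

lemma hcat_mult_vcat: "hcat X Y *v vcat y z = X *v y + Y *v z"
  by (simp add: vec_eq_iff hcat_def vcat_def matrix_vector_mult_def sum_UNIV_sum)

lemma inner_vcat: "vcat y z \<bullet> vcat y' z' = y \<bullet> y' + z \<bullet> z'"
  by (simp add: inner_vec_def vcat_def sum_UNIV_sum)

lemma norm_vcat: "(norm (vcat y z))\<^sup>2 = (norm y)\<^sup>2 + (norm z)\<^sup>2"
  by (simp add: power2_norm_eq_inner inner_vcat)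

lemma vcat_cases: obtains y z where "x = vcat y z"
proof
  show "x = vcat (\<chi> a. x $ Inl a) (\<chi> b. x $ Inr b)"
    by (simp add: vec_eq_iff vcat_def split: sum.split)
qed

lemma norm_le_norm_vcat: "norm y \<le> norm (vcat y z)" "norm z \<le> norm (vcat y z)"
  by (rule power2_le_imp_le; simp add: norm_vcat)+

text \<open>This turns the block \<open>\<kappa> [U\<^sup>T F\<^sup>T]\<close> of the linear matrix inequality into an inner product with
  the vector \<open>(U x, F x)\<close>, whose norm is controlled by a bound on the gain.\<close>

lemma inner_transpose_hcat:
  "x \<bullet> (hcat (transpose U) (transpose V) *v u) = vcat (U *v x) (V *v x) \<bullet> u"
proof -
  obtain y z where u: "u = vcat y z" by (rule vcat_cases)
  show ?thesis
    by (simp add: u hcat_mult_vcat inner_vcat inner_add_right inner_transpose_mult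
        del: transpose_matrix_vector)
qed

section \<open>The quadratic form of the linear matrix inequality\<close>

lemma sum_lmi_indices:
  "(\<Sum>p\<in>lmi_indices N. f p) =
    (\<Sum>a\<in>UNIV. f (Ix1 a)) + (\<Sum>j<N. \<Sum>a\<in>UNIV. f (Ix2 j a)) +
    (\<Sum>j<N. \<Sum>a\<in>UNIV. f (Ix3 j a)) + (\<Sum>b\<in>UNIV. f (Ix4 b))"
  for f :: "('n::finite, 'm::finite) lmi_index \<Rightarrow> real"
proof -
  have 2: "{Ix2 j a :: ('n, 'm) lmi_index | j a. j < N} = case_prod Ix2 ` ({..<N} \<times> UNIV)"
    and 3: "{Ix3 j a :: ('n, 'm) lmi_index | j a. j < N} = case_prod Ix3 ` ({..<N} \<times> UNIV)"
    by force+
  have inj: "inj_on (case_prod Ix2 :: _ \<Rightarrow> ('n, 'm) lmi_index) X"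
    "inj_on (case_prod Ix3 :: _ \<Rightarrow> ('n, 'm) lmi_index) X" for X
    by (auto simp: inj_on_def)
  show ?thesis
    unfolding lmi_indices_def 2 3
    by (subst sum.union_disjoint, simp, simp, force)+
      (simp add: sum.reindex inj inj_on_def sum.cartesian_product o_def split_def)
qed

text \<open>The quadratic form of the large matrix in terms of its block vectors.  All that follows about
  definiteness is done on this expression, so that no matrix algebra in dimension \<open>n N\<close> is needed.\<close>

lemma lmi_matrix_form:
  fixes \<Gamma>A :: "nat \<Rightarrow> real^'n^'n" and \<Gamma>B :: "nat \<Rightarrow> real^'m^'n"
    and x :: "('n, 'm) lmi_index \<Rightarrow> real"
  defines "x1 \<equiv> \<chi> a. x (Ix1 a)" and "x2 \<equiv> \<lambda>j. \<chi> a. x (Ix2 j a)"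
    and "x3 \<equiv> \<lambda>j. \<chi> a. x (Ix3 j a)" and "x4 \<equiv> \<chi> b. x (Ix4 b)"
  shows "(\<Sum>p\<in>lmi_indices N. \<Sum>q\<in>lmi_indices N. x p * lmi_matrix i \<Gamma>A \<Gamma>B \<kappa> R U Fb l p q * x q) =
    x1 \<bullet> ((U + transpose U - R i) *v x1)
    + (\<Sum>j<N. 2 * ((\<Gamma>A j *v (U *v x1) + \<Gamma>B j *v (Fb *v x1)) \<bullet> x3 j) + x3 j \<bullet> (R j *v x3 j)
          + l * (norm (x2 j))\<^sup>2 + 2 * l * (x2 j \<bullet> x3 j))
    + 2 * \<kappa> * (vcat (U *v x1) (Fb *v x1) \<bullet> x4) + l * (norm x4)\<^sup>2"
proof -
  let ?L = "lmi_matrix i \<Gamma>A \<Gamma>B \<kappa> R U Fb l"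
  have inner: "u \<bullet> (X *v v) = (\<Sum>a\<in>UNIV. \<Sum>b\<in>UNIV. u $ a * X $ a $ b * v $ b)"
    for u :: "real^'r" and X :: "real^'s^'r" and v
    by (simp add: inner_vec_def matrix_vector_mult_def sum_distrib_left mult.assoc)
  have block: "(\<Sum>a\<in>UNIV. \<Sum>b\<in>UNIV. f a * X $ a $ b * h b) = (\<chi> a. f a) \<bullet> (X *v (\<chi> b. h b))"
    for f :: "'r::finite \<Rightarrow> real" and h :: "'s::finite \<Rightarrow> real" and X
    by (simp add: inner)
  have block': "(\<Sum>a\<in>UNIV. \<Sum>b\<in>UNIV. f a * X $ b $ a * h b) = (\<chi> a. h a) \<bullet> (X *v (\<chi> b. f b))"
    for f :: "'r::finite \<Rightarrow> real" and h :: "'s::finite \<Rightarrow> real" and X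
    by (subst sum.swap) (simp add: inner mult_ac)
  have diag: "(\<Sum>a\<in>UNIV. \<Sum>k<N. \<Sum>b\<in>UNIV. f a * (if j = k \<and> a = b then l else 0) * h k b)
      = l * ((\<chi> a. f a) \<bullet> (\<chi> b. h j b))" if "j < N"
    for f :: "'r::finite \<Rightarrow> real" and h :: "nat \<Rightarrow> 'r \<Rightarrow> real" and j
  proof -
    have "f a * (if j = k \<and> a = b then l else 0) * h k b
        = (if b = a then if k = j then f a * l * h k b else 0 else 0)" for a b k
      by auto
    then have "(\<Sum>k<N. \<Sum>b\<in>UNIV. f a * (if j = k \<and> a = b then l else 0) * h k b)
        = f a * l * h j a" for a
      using that by (simp only: sum.delta finite finite_lessThan lessThan_iff UNIV_I if_True)
    then show ?thesis by (simp add: inner_vec_def sum_distrib_left mult_ac)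
  qed
  have Rblk: "(\<Sum>a\<in>UNIV. \<Sum>k<N. \<Sum>b\<in>UNIV. x (Ix3 j a) * (if j = k then R j $ a $ b else 0) * x (Ix3 k b))
      = x3 j \<bullet> (R j *v x3 j)" if "j < N" for j
  proof -
    have "(\<Sum>b\<in>UNIV. x (Ix3 j a) * (if j = k then R j $ a $ b else 0) * x (Ix3 k b))
        = (if k = j then (\<Sum>b\<in>UNIV. x (Ix3 j a) * R j $ a $ b * x (Ix3 k b)) else 0)" for a k
      by auto
    then have "(\<Sum>k<N. \<Sum>b\<in>UNIV. x (Ix3 j a) * (if j = k then R j $ a $ b else 0) * x (Ix3 k b))
        = (\<Sum>b\<in>UNIV. x (Ix3 j a) * R j $ a $ b * x (Ix3 j b))" for a
      using that by (simp only: sum.delta finite finite_lessThan lessThan_iff if_True)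
    then show ?thesis by (simp only: x3_def block)
  qed
  have blk_sym: "(\<chi> a. x (Ix1 a)) = x1" "(\<chi> a. x (Ix2 j a)) = x2 j"
    "(\<chi> a. x (Ix3 j a)) = x3 j" "(\<chi> b. x (Ix4 b)) = x4" for j
    by (simp_all add: x1_def x2_def x3_def x4_def)
  have G: "x1 \<bullet> ((transpose U ** transpose (\<Gamma>A j) + transpose Fb ** transpose (\<Gamma>B j)) *v v)
      = (\<Gamma>A j *v (U *v x1) + \<Gamma>B j *v (Fb *v x1)) \<bullet> v" for j v
    by (simp add: matrix_vector_mult_add_rdistrib inner_add_right inner_add_left
        matrix_vector_mul_assoc[symmetric] inner_transpose_mult del: transpose_matrix_vector)
  have H: "x1 \<bullet> ((\<kappa> *\<^sub>R hcat (transpose U) (transpose Fb)) *v v)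
      = \<kappa> * (vcat (U *v x1) (Fb *v x1) \<bullet> v)" for v
    by (simp add: scaleR_matrix_vector_assoc[symmetric] inner_transpose_hcat)
  \<comment> \<open>\<open>b1\<close> to \<open>b4\<close> evaluate the four block rows; each off-diagonal block is met in two of them.\<close>
  have b1: "(\<Sum>a\<in>UNIV. \<Sum>q\<in>lmi_indices N. x (Ix1 a) * ?L (Ix1 a) q * x q) =
      x1 \<bullet> ((U + transpose U - R i) *v x1)
      + (\<Sum>j<N. (\<Gamma>A j *v (U *v x1) + \<Gamma>B j *v (Fb *v x1)) \<bullet> x3 j)
      + \<kappa> * (vcat (U *v x1) (Fb *v x1) \<bullet> x4)"
  proof -
    have "(\<Sum>a\<in>UNIV. \<Sum>j<N. \<Sum>b\<in>UNIV. x (Ix1 a) *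
        (transpose U ** transpose (\<Gamma>A j) + transpose Fb ** transpose (\<Gamma>B j)) $ a $ b * x (Ix3 j b))
      = (\<Sum>j<N. (\<Gamma>A j *v (U *v x1) + \<Gamma>B j *v (Fb *v x1)) \<bullet> x3 j)"
      by (subst sum.swap) (simp only: block G blk_sym)
    moreover have "(\<Sum>a\<in>UNIV. \<Sum>b\<in>UNIV. x (Ix1 a) *
        (\<kappa> *\<^sub>R hcat (transpose U) (transpose Fb)) $ a $ b * x (Ix4 b))
        = \<kappa> * (vcat (U *v x1) (Fb *v x1) \<bullet> x4)"
      by (simp only: block H blk_sym)
    moreover have "(\<Sum>a\<in>UNIV. \<Sum>b\<in>UNIV. x (Ix1 a) * (U + transpose U - R i) $ a $ b * x (Ix1 b))
        = x1 \<bullet> ((U + transpose U - R i) *v x1)"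
      by (simp only: block blk_sym)
    ultimately show ?thesis
      by (simp only: sum_lmi_indices lmi_matrix.simps sum.distrib) simp
  qed
  have b2: "(\<Sum>j<N. \<Sum>a\<in>UNIV. \<Sum>q\<in>lmi_indices N. x (Ix2 j a) * ?L (Ix2 j a) q * x q) =
      (\<Sum>j<N. l * (norm (x2 j))\<^sup>2 + l * (x2 j \<bullet> x3 j))"
    by (intro sum.cong refl)
      (simp add: sum_lmi_indices sum.distrib diag x2_def x3_def power2_norm_eq_inner)
  have b3: "(\<Sum>j<N. \<Sum>a\<in>UNIV. \<Sum>q\<in>lmi_indices N. x (Ix3 j a) * ?L (Ix3 j a) q * x q) =
      (\<Sum>j<N. (\<Gamma>A j *v (U *v x1) + \<Gamma>B j *v (Fb *v x1)) \<bullet> x3 j + l * (x2 j \<bullet> x3 j)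
        + x3 j \<bullet> (R j *v x3 j))"
  proof (intro sum.cong refl)
    fix j assume "j \<in> {..<N}"
    then have "j < N" by simp
    have "(\<Sum>a\<in>UNIV. \<Sum>b\<in>UNIV. x (Ix3 j a) *
        (transpose U ** transpose (\<Gamma>A j) + transpose Fb ** transpose (\<Gamma>B j)) $ b $ a * x (Ix1 b))
      = (\<Gamma>A j *v (U *v x1) + \<Gamma>B j *v (Fb *v x1)) \<bullet> x3 j"
      by (simp only: block' G blk_sym)
    then show "(\<Sum>a\<in>UNIV. \<Sum>q\<in>lmi_indices N. x (Ix3 j a) * ?L (Ix3 j a) q * x q) =
      (\<Gamma>A j *v (U *v x1) + \<Gamma>B j *v (Fb *v x1)) \<bullet> x3 j + l * (x2 j \<bullet> x3 j) + x3 j \<bullet> (R j *v x3 j)"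
      using diag[OF \<open>j < N\<close>, of "\<lambda>a. x (Ix3 j a)" "\<lambda>k b. x (Ix2 k b)"] Rblk[OF \<open>j < N\<close>]
      by (simp only: sum_lmi_indices lmi_matrix.simps sum.distrib)
        (simp add: x2_def x3_def inner_commute)
  qed
  have b4: "(\<Sum>c\<in>UNIV. \<Sum>q\<in>lmi_indices N. x (Ix4 c) * ?L (Ix4 c) q * x q) =
      \<kappa> * (vcat (U *v x1) (Fb *v x1) \<bullet> x4) + l * (norm x4)\<^sup>2"
  proof -
    have "(\<Sum>b\<in>UNIV. \<Sum>a\<in>UNIV. x (Ix4 b) *
        (\<kappa> *\<^sub>R hcat (transpose U) (transpose Fb)) $ a $ b * x (Ix1 a))
        = \<kappa> * (vcat (U *v x1) (Fb *v x1) \<bullet> x4)"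
      by (simp only: block' H blk_sym)
    moreover have "(\<Sum>b\<in>UNIV. \<Sum>c\<in>UNIV. x (Ix4 b) * (if b = c then l else 0) * x (Ix4 c))
        = l * (norm x4)\<^sup>2"
    proof -
      have "x (Ix4 b) * (if b = c then l else 0) * x (Ix4 c)
          = (if c = b then l * (x (Ix4 c) * x (Ix4 c)) else 0)" for b c
        by auto
      then show ?thesis
        by (simp add: power2_norm_eq_inner inner_vec_def x4_def sum_distrib_left)
    qed
    ultimately show ?thesis
      by (simp only: sum_lmi_indices lmi_matrix.simps sum.distrib) simp
  qed
  show ?thesis
    unfolding sum_lmi_indices[where f = "\<lambda>p. \<Sum>q\<in>lmi_indices N. x p * ?L p q * x q"] b1 b2 b3 b4
    by (simp add: sum.distrib sum_distrib_left mult_ac)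
qed

section \<open>From a Riccati inequality to the linear matrix inequality\<close>

text \<open>With \<open>R = S\<^sup>-\<^sup>1\<close>, \<open>U = R i\<close> and the gain multiplied by \<open>R i\<close>, the substitution \<open>x1 = S i y\<close> makes the
  first diagonal block \<open>y \<bullet> S i y\<close>, and minimising the form over the other block vectors gives a
  Riccati expression: Young's inequality over \<open>x3 j\<close> costs the weighted sum of the
  \<open>K y \<bullet> S j (K y)\<close>, where \<open>K = A + B F\<close>.  The blocks containing \<open>l\<close> and \<open>\<kappa>\<close> are paid for out of the
  margin \<open>\<eta>\<close>.  The coupling \<open>l I\<close> of \<open>x2 j\<close> and \<open>x3 j\<close> subtracts \<open>l I\<close> from every \<open>R j\<close>, which is
  harmless since \<open>R j\<close> dominates \<open>I / s\<close> and \<open>l\<close> is a small multiple of \<open>1 / s\<close>.  The last block costs \<open>\<kappa>\<^sup>2 / l\<close>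
  times a constant.  Hence \<open>l\<close> may be fixed first, from \<open>s\<close> and \<open>\<eta>\<close> only, and \<open>\<kappa>\<close> afterwards.\<close>

lemma riccati_imp_lmi:
  fixes S :: "nat \<Rightarrow> real^'n^'n" and A :: "real^'n^'n" and B :: "real^'m^'n" and F :: "real^'n^'m"
  assumes i: "i < N" and "s > 0" "\<eta> > 0"
    and S: "\<And>j. j < N \<Longrightarrow> posdef (S j)"
    and le: "\<And>j v. j < N \<Longrightarrow> v \<bullet> (S j *v v) \<le> s * (norm v)\<^sup>2"
    and w: "\<And>j. j < N \<Longrightarrow> 0 \<le> w j"
    and ric: "\<And>y. \<eta> * (norm y)\<^sup>2
      + (\<Sum>j<N. w j * ((A *v y + B *v (F *v y)) \<bullet> (S j *v (A *v y + B *v (F *v y))))) \<le> y \<bullet> (S i *v y)"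
    and F: "\<And>y. norm (F *v y) \<le> f * norm y"
    and l: "l = \<eta> / (2 * s * (\<eta> + 4 * s))"
    and \<kappa>: "8 * \<kappa>\<^sup>2 * (1 + f\<^sup>2) \<le> \<eta> * l"
  shows "posdef_on (lmi_indices N) (lmi_matrix i (\<lambda>j. sqrt (w j) *\<^sub>R A) (\<lambda>j. sqrt (w j) *\<^sub>R B) \<kappa>
    (\<lambda>j. matrix_inv (S j)) (matrix_inv (S i)) (F ** matrix_inv (S i)) l)"
proof -
  let ?R = "\<lambda>j. matrix_inv (S j)"
  let ?X = "lmi_matrix i (\<lambda>j. sqrt (w j) *\<^sub>R A) (\<lambda>j. sqrt (w j) *\<^sub>R B) \<kappa> ?R (?R i) (F ** ?R i) l"
  have "l > 0" using \<open>s > 0\<close> \<open>\<eta> > 0\<close> by (simp add: l)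
  have Rsym: "transpose (?R j) = ?R j" if "j < N" for j
    using posdef_matrix_inv[OF S[OF that]] by (simp add: posdef_def)
  have Rsym': "?R j $ a $ b = ?R j $ b $ a" if "j < N" for j a b
    using arg_cong[OF Rsym[OF that], of "\<lambda>X. X $ a $ b"] by (simp add: transpose_def)
  have "?X p q = ?X q p" if "p \<in> lmi_indices N" "q \<in> lmi_indices N" for p q
    using that i by (cases p; cases q) (auto simp: lmi_indices_def Rsym Rsym')
  moreover have "0 < (\<Sum>p\<in>lmi_indices N. \<Sum>q\<in>lmi_indices N. x p * ?X p q * x q)"
    if nz: "\<exists>p\<in>lmi_indices N. x p \<noteq> 0" for x :: "('n, 'm) lmi_index \<Rightarrow> real"
  proof -
    define x1 where "x1 = (\<chi> a. x (Ix1 a))"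
    define x2 where "x2 = (\<lambda>j. \<chi> a. x (Ix2 j a))"
    define x3 where "x3 = (\<lambda>j. \<chi> a. x (Ix3 j a))"
    define x4 where "x4 = (\<chi> b. x (Ix4 b))"
    define y where "y = ?R i *v x1"
    define k where "k = A *v y + B *v (F *v y)"
    define z where "z = vcat y (F *v y)"
    define t where "t = 1 + \<eta> / (4 * s)"
    define \<Sigma> where "\<Sigma> = (\<Sum>j<N. w j * (k \<bullet> (S j *v k)))"
    \<comment> \<open>\<open>t\<close> splits \<open>R j\<close>: the share \<open>1 / t\<close> absorbs the cross term with \<open>k\<close>, the share \<open>1 - 1 / t\<close>
      dominates \<open>2 l I\<close>.  The price is a factor \<open>t\<close> in front of \<open>\<Sigma>\<close>,
      which adds at most a quarter of the margin.\<close>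
    have "t > 1" using \<open>s > 0\<close> \<open>\<eta> > 0\<close> by (simp add: t_def)
    then have "t > 0" by simp
    have t: "(1 - 1 / t) / s = 2 * l"
    proof -
      have "1 / t = 4 * s / (\<eta> + 4 * s)"
        using \<open>s > 0\<close> \<open>\<eta> > 0\<close> by (simp add: t_def field_simps)
      moreover have "1 - 4 * s / (\<eta> + 4 * s) = \<eta> / (\<eta> + 4 * s)"
        using \<open>s > 0\<close> \<open>\<eta> > 0\<close> by (simp add: field_simps)
      ultimately have "1 - 1 / t = \<eta> / (\<eta> + 4 * s)" by simp
      moreover have "\<eta> / D / s = 2 * (\<eta> / (2 * s * D))" for D by (simp add: mult_ac)
      ultimately show ?thesis by (simp only: l)
    qed
    have x1: "S i *v y = x1" unfolding y_def by (rule posdef_mult_inv[OF S[OF i]])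
    have form: "(\<Sum>p\<in>lmi_indices N. \<Sum>q\<in>lmi_indices N. x p * ?X p q * x q) = y \<bullet> (S i *v y)
      + (\<Sum>j<N. 2 * sqrt (w j) * (k \<bullet> x3 j) + x3 j \<bullet> (?R j *v x3 j)
          + l * (norm (x2 j))\<^sup>2 + 2 * l * (x2 j \<bullet> x3 j))
      + 2 * \<kappa> * (z \<bullet> x4) + l * (norm x4)\<^sup>2"
    proof -
      have "x1 \<bullet> ((?R i + transpose (?R i) - ?R i) *v x1) = y \<bullet> (S i *v y)"
        by (simp add: Rsym[OF i] x1) (simp add: y_def inner_commute)
      moreover have "(sqrt (w j) *\<^sub>R A) *v (?R i *v x1) + (sqrt (w j) *\<^sub>R B) *v ((F ** ?R i) *v x1)
          = sqrt (w j) *\<^sub>R k" for j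
        by (simp add: k_def y_def matrix_vector_mul_assoc[symmetric] scaleR_matrix_vector_assoc[symmetric]
            scaleR_add_right)
      moreover have "vcat (?R i *v x1) ((F ** ?R i) *v x1) = z"
        by (simp add: z_def y_def matrix_vector_mul_assoc)
      ultimately show ?thesis
        unfolding lmi_matrix_form x1_def[symmetric] x2_def[symmetric] x3_def[symmetric] x4_def[symmetric]
        by (simp add: x2_def x3_def mult.assoc)
    qed
    have block: "- t * (w j * (k \<bullet> (S j *v k))) + l * ((norm (x3 j))\<^sup>2 + (norm (x2 j + x3 j))\<^sup>2)
        \<le> 2 * sqrt (w j) * (k \<bullet> x3 j) + x3 j \<bullet> (?R j *v x3 j)
          + l * (norm (x2 j))\<^sup>2 + 2 * l * (x2 j \<bullet> x3 j)" if "j < N" for j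
    proof -
      let ?q = "x3 j \<bullet> (?R j *v x3 j)"
      have "0 \<le> ?q + 2 * (((t * sqrt (w j)) *\<^sub>R k) \<bullet> x3 j)
          + ((t * sqrt (w j)) *\<^sub>R k) \<bullet> (S j *v ((t * sqrt (w j)) *\<^sub>R k))"
        by (rule Young_matrix_inv[OF S[OF that]])
      also have "\<dots> = t * (?q / t + 2 * sqrt (w j) * (k \<bullet> x3 j) + t * (w j * (k \<bullet> (S j *v k))))"
        using w[OF that] \<open>t > 0\<close>
        by (simp add: matrix_vector_mult_scaleR algebra_simps
            power2_eq_square[symmetric] real_sqrt_mult_self[symmetric] del: real_sqrt_mult_self)
      finally have young: "0 \<le> ?q / t + 2 * sqrt (w j) * (k \<bullet> x3 j) + t * (w j * (k \<bullet> (S j *v k)))"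
        using \<open>t > 0\<close> by (simp add: zero_le_mult_iff)
      have "2 * l * (norm (x3 j))\<^sup>2 = (1 - 1 / t) * ((norm (x3 j))\<^sup>2 / s)"
        by (simp add: t[symmetric])
      also have "\<dots> \<le> (1 - 1 / t) * ?q"
        using \<open>s > 0\<close> \<open>t > 1\<close> by (intro mult_left_mono matrix_inv_form_ge S le that) simp_all
      finally have "2 * l * (norm (x3 j))\<^sup>2 \<le> ?q - ?q / t" by (simp add: left_diff_distrib)
      moreover have "(norm (x2 j + x3 j))\<^sup>2 = (norm (x2 j))\<^sup>2 + 2 * (x2 j \<bullet> x3 j) + (norm (x3 j))\<^sup>2"
        by (simp add: power2_norm_eq_inner inner_add_left inner_add_right inner_commute)
      ultimately show ?thesis using young by (simp add: algebra_simps)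
    qed
    \<comment> \<open>Only half of \<open>l |x4|\<^sup>2\<close> goes into completing the square, so that a strictly positive term in
      \<open>x4\<close> survives.\<close>
    have last: "l / 2 * (norm x4)\<^sup>2 - \<eta> / 4 * (norm y)\<^sup>2 \<le> 2 * \<kappa> * (z \<bullet> x4) + l * (norm x4)\<^sup>2"
    proof -
      have "(norm z)\<^sup>2 = (norm y)\<^sup>2 + (norm (F *v y))\<^sup>2" by (simp add: z_def norm_vcat)
      also have "\<dots> \<le> (norm y)\<^sup>2 + (f * norm y)\<^sup>2" by (intro add_left_mono power_mono F) simp
      finally have z: "(norm z)\<^sup>2 \<le> (1 + f\<^sup>2) * (norm y)\<^sup>2" by (simp add: algebra_simps)
      have "2 * \<kappa>\<^sup>2 / l * (norm z)\<^sup>2 \<le> 2 * \<kappa>\<^sup>2 / l * ((1 + f\<^sup>2) * (norm y)\<^sup>2)"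
        using \<open>l > 0\<close> z by (intro mult_left_mono) auto
      also have "\<dots> = (8 * \<kappa>\<^sup>2 * (1 + f\<^sup>2)) * ((norm y)\<^sup>2 / (4 * l))" by simp
      also have "\<dots> \<le> (\<eta> * l) * ((norm y)\<^sup>2 / (4 * l))"
        using \<open>l > 0\<close> by (intro mult_right_mono \<kappa>) auto
      also have "\<dots> = \<eta> / 4 * (norm y)\<^sup>2" using \<open>l > 0\<close> by simp
      finally have 1: "2 * \<kappa>\<^sup>2 / l * (norm z)\<^sup>2 \<le> \<eta> / 4 * (norm y)\<^sup>2" .
      have "0 \<le> l / 2 * (norm (x4 + (2 * \<kappa> / l) *\<^sub>R z))\<^sup>2" using \<open>l > 0\<close> by simp
      also have "\<dots> = l / 2 * (norm x4)\<^sup>2 + 2 * \<kappa> * (z \<bullet> x4) + 2 * \<kappa>\<^sup>2 / l * (norm z)\<^sup>2"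
      proof -
        have "(norm (x4 + c *\<^sub>R z))\<^sup>2 = (norm x4)\<^sup>2 + 2 * c * (z \<bullet> x4) + c\<^sup>2 * (norm z)\<^sup>2" for c
          unfolding power2_norm_eq_inner
          by (simp add: inner_add_left inner_add_right inner_commute power2_eq_square)
        then show ?thesis
          using \<open>l > 0\<close> by (simp only:) (simp add: field_simps power2_eq_square)
      qed
      finally show ?thesis using 1 by simp
    qed
    have \<Sigma>: "\<eta> * (norm y)\<^sup>2 + \<Sigma> \<le> y \<bullet> (S i *v y)"
      unfolding \<Sigma>_def k_def by (rule ric)
    have "\<Sigma> \<le> s * (norm y)\<^sup>2"
      using \<Sigma> le[OF i, of y] \<open>\<eta> > 0\<close> by (smt (verit) mult_nonneg_nonneg zero_le_power2)
    then have "\<eta> / (4 * s) * \<Sigma> \<le> \<eta> / (4 * s) * (s * (norm y)\<^sup>2)"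
      using \<open>s > 0\<close> \<open>\<eta> > 0\<close> by (intro mult_left_mono) auto
    then have t\<Sigma>: "t * \<Sigma> \<le> \<Sigma> + \<eta> / 4 * (norm y)\<^sup>2"
      using \<open>s > 0\<close> by (simp add: t_def distrib_right)
    define P where "P = (\<Sum>j<N. (norm (x3 j))\<^sup>2 + (norm (x2 j + x3 j))\<^sup>2)"
    have "- t * \<Sigma> + l * P
      = (\<Sum>j<N. - t * (w j * (k \<bullet> (S j *v k))) + l * ((norm (x3 j))\<^sup>2 + (norm (x2 j + x3 j))\<^sup>2))"
      unfolding \<Sigma>_def P_def sum_distrib_left by (rule sum.distrib[symmetric])
    also have "\<dots> \<le> (\<Sum>j<N. 2 * sqrt (w j) * (k \<bullet> x3 j) + x3 j \<bullet> (?R j *v x3 j)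
          + l * (norm (x2 j))\<^sup>2 + 2 * l * (x2 j \<bullet> x3 j))"
      by (intro sum_mono block) simp
    finally have lower: "\<eta> / 2 * (norm y)\<^sup>2 + l * P + l / 2 * (norm x4)\<^sup>2
        \<le> (\<Sum>p\<in>lmi_indices N. \<Sum>q\<in>lmi_indices N. x p * ?X p q * x q)"
      unfolding form using last \<Sigma> t\<Sigma> by simp
    have "P \<ge> 0" unfolding P_def by (intro sum_nonneg) simp
    have "\<not> (y = 0 \<and> P = 0 \<and> x4 = 0)"
    proof
      assume *: "y = 0 \<and> P = 0 \<and> x4 = 0"
      have "x3 j = 0 \<and> x2 j = 0" if "j < N" for j
      proof -
        have "\<forall>j\<in>{..<N}. (norm (x3 j))\<^sup>2 + (norm (x2 j + x3 j))\<^sup>2 = 0"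
          using * unfolding P_def
          by (intro sum_nonneg_eq_0_iff[THEN iffD1]) (simp_all only: finite_lessThan, simp_all)
        then have "(norm (x3 j))\<^sup>2 + (norm (x2 j + x3 j))\<^sup>2 = 0" using that by blast
        then have "x3 j = 0 \<and> x2 j + x3 j = 0" by (auto simp: add_nonneg_eq_0_iff)
        then show ?thesis by auto
      qed
      moreover have "x1 = 0" using * x1 by auto
      ultimately have "x p = 0" if "p \<in> lmi_indices N" for p
        using * that unfolding lmi_indices_def x1_def x2_def x3_def x4_def
        by (auto simp: vec_eq_iff)
      with nz show False by blast
    qed
    then have "\<eta> / 2 * (norm y)\<^sup>2 \<noteq> 0 \<or> l * P \<noteq> 0 \<or> l / 2 * (norm x4)\<^sup>2 \<noteq> 0"
      using \<open>l > 0\<close> \<open>\<eta> > 0\<close> by auto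
    moreover have "0 \<le> \<eta> / 2 * (norm y)\<^sup>2" "0 \<le> l * P" "0 \<le> l / 2 * (norm x4)\<^sup>2"
      using \<open>P \<ge> 0\<close> \<open>l > 0\<close> \<open>\<eta> > 0\<close> by simp_all
    ultimately show ?thesis using lower by linarith
  qed
  ultimately show ?thesis unfolding posdef_on_def by blast
qed

section \<open>Freezing the Riccati inequality at the centre of a box\<close>

text \<open>Closeness of square roots of probability vectors (Hellinger distance) controls the
  \<open>L\<^sup>1\<close> distance: factor \<open>p - q = (\<surd>p - \<surd>q) (\<surd>p + \<surd>q)\<close> and apply Cauchy-Schwarz.\<close>

lemma sum_abs_diff_le_L2_sqrt:
  fixes p q :: "'i \<Rightarrow> real"
  assumes "\<And>j. j \<in> J \<Longrightarrow> 0 \<le> p j" "\<And>j. j \<in> J \<Longrightarrow> 0 \<le> q j" "sum p J \<le> 1" "sum q J \<le> 1"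
  shows "(\<Sum>j\<in>J. \<bar>p j - q j\<bar>) \<le> 2 * L2_set (\<lambda>j. sqrt (p j) - sqrt (q j)) J"
proof -
  have root: "L2_set (\<lambda>j. sqrt (r j)) J \<le> 1"
    if "\<And>j. j \<in> J \<Longrightarrow> 0 \<le> r j" "sum r J \<le> 1" for r :: "'i \<Rightarrow> real"
    using that by (simp add: L2_set_def)
  have "\<bar>p j - q j\<bar> = \<bar>sqrt (p j) - sqrt (q j)\<bar> * \<bar>sqrt (p j) + sqrt (q j)\<bar>" if "j \<in> J" for j
  proof -
    have "p j - q j = (sqrt (p j) - sqrt (q j)) * (sqrt (p j) + sqrt (q j))"
      using assms(1,2)[OF that] by (simp add: algebra_simps)
    then show ?thesis by (metis abs_mult)
  qed
  then have "(\<Sum>j\<in>J. \<bar>p j - q j\<bar>)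
      = (\<Sum>j\<in>J. \<bar>sqrt (p j) - sqrt (q j)\<bar> * \<bar>sqrt (p j) + sqrt (q j)\<bar>)"
    by simp
  also have "\<dots> \<le> L2_set (\<lambda>j. sqrt (p j) - sqrt (q j)) J * L2_set (\<lambda>j. sqrt (p j) + sqrt (q j)) J"
    by (rule L2_set_mult_ineq)
  also have "\<dots> \<le> L2_set (\<lambda>j. sqrt (p j) - sqrt (q j)) J * 2"
  proof (rule mult_left_mono)
    show "L2_set (\<lambda>j. sqrt (p j) + sqrt (q j)) J \<le> 2"
      using L2_set_triangle_ineq[of "\<lambda>j. sqrt (p j)" "\<lambda>j. sqrt (q j)" J] root[of p] root[of q] assms
      by fastforce
  qed simp
  finally show ?thesis by (simp add: mult.commute)
qed

text \<open>The primed data are those at a typical point \<open>\<phi>\<close> of a box, the others the frozen data of that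
  box.  The margin \<open>\<epsilon>\<close> at \<open>\<phi>\<close> pays for five replacements: \<open>S(\<phi>)\<close> by \<open>S i\<close>, the expectation \<open>G\<close> of \<open>S\<close>
  by that of the step function, the transition probabilities from \<open>\<phi>\<close> by those from the centre,
  the plant and the gain.  The constants in \<open>small\<close> depend on a priori bounds
  only, and not on \<open>N\<close>, because each \<open>S j\<close> is weighted by a probability.\<close>

lemma riccati_perturbation:
  fixes S :: "nat \<Rightarrow> real^'n^'n" and A A' G S' :: "real^'n^'n" and B B' :: "real^'m^'n"
    and F F' :: "real^'n^'m"
  assumes ric: "psd (S' - transpose (A' + B' ** F') ** G ** (A' + B' ** F') - \<epsilon> *\<^sub>R mat 1)"
    and S: "\<And>j. j < N \<Longrightarrow> posdef (S j)" "\<And>j v. j < N \<Longrightarrow> norm (S j *v v) \<le> s * norm v"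
    and G: "\<And>v. (\<Sum>j<N. w' j * (v \<bullet> (S j *v v))) \<le> v \<bullet> (G *v v) + e * (norm v)\<^sup>2"
    and SS': "\<And>v. v \<bullet> (S' *v v) \<le> v \<bullet> (S i *v v) + e * (norm v)\<^sup>2"
    and FF': "\<And>v. norm (F' *v v - F *v v) \<le> e * norm v"
    and AA': "\<And>v. norm (A' *v v - A *v v) \<le> e' * norm v"
    and BB': "\<And>v. norm (B' *v v - B *v v) \<le> e' * norm v"
    and w: "\<And>j. j < N \<Longrightarrow> 0 \<le> w j" "(\<Sum>j<N. w j) \<le> 1"
    and ww': "(\<Sum>j<N. \<bar>w j - w' j\<bar>) \<le> 2 * e'"
    and a: "\<And>v. norm (A *v v) \<le> a * norm v" "\<And>v. norm (A' *v v) \<le> a * norm v"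
    and b: "\<And>v. norm (B *v v) \<le> b * norm v" "\<And>v. norm (B' *v v) \<le> b * norm v"
    and f: "\<And>v. norm (F *v v) \<le> f * norm v" "\<And>v. norm (F' *v v) \<le> f * norm v"
    and nonneg: "0 \<le> s" "0 \<le> a" "0 \<le> b" "0 \<le> f" "0 \<le> e" "0 \<le> e'"
    and small: "\<eta> + e * (1 + (a + b * f)\<^sup>2 + 2 * s * (a + b * f) * b)
      + e' * (2 * s * (a + b * f)\<^sup>2 + 2 * s * (a + b * f) * (1 + f)) \<le> \<epsilon>"
  shows "\<eta> * (norm y)\<^sup>2
      + (\<Sum>j<N. w j * ((A *v y + B *v (F *v y)) \<bullet> (S j *v (A *v y + B *v (F *v y))))) \<le> y \<bullet> (S i *v y)"
proof -
  define k where "k = a + b * f"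
  define u where "u = A *v y + B *v (F *v y)"
  define v where "v = A' *v y + B' *v (F' *v y)"
  define d where "d = e' * (1 + f) + b * e"
  have quad: "\<bar>x \<bullet> (S j *v z)\<bar> \<le> s * (norm x * norm z)" if "j < N" for j x z
  proof -
    have "\<bar>x \<bullet> (S j *v z)\<bar> \<le> norm x * norm (S j *v z)" by (rule Cauchy_Schwarz_ineq2)
    also have "\<dots> \<le> norm x * (s * norm z)" by (intro mult_left_mono S that) simp
    finally show ?thesis by (simp add: mult_ac)
  qed
  have BF: "norm (X *v (Y *v y)) \<le> b * f * norm y"
    if "\<And>v. norm (X *v v) \<le> b * norm v" "\<And>v. norm (Y *v v) \<le> f * norm v"
    for X :: "real^'m^'n" and Y :: "real^'n^'m"
    using that(1)[of "Y *v y"] mult_left_mono[OF that(2)[of y] \<open>0 \<le> b\<close>] by (simp add: mult.assoc)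
  have u: "norm u \<le> k * norm y" and v: "norm v \<le> k * norm y"
    unfolding u_def v_def k_def distrib_right
    by (intro order_trans[OF norm_triangle_ineq] add_mono a BF b f)+
  have "k \<ge> 0" using nonneg by (simp add: k_def)
  have v2: "(norm v)\<^sup>2 \<le> k\<^sup>2 * (norm y)\<^sup>2"
    using power_mono[OF v, of 2] by (simp add: power_mult_distrib)
  have uv: "norm (u - v) \<le> d * norm y"
  proof -
    have 1: "norm (A *v y - A' *v y) \<le> e' * norm y"
      using AA'[of y] by (simp add: norm_minus_commute)
    have 2: "norm (B *v (F *v y) - B' *v (F *v y)) \<le> e' * f * norm y"
      using BB'[of "F *v y"] mult_left_mono[OF f(1)[of y] \<open>0 \<le> e'\<close>]
      by (simp add: norm_minus_commute mult.assoc)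
    have 3: "norm (B' *v (F *v y - F' *v y)) \<le> b * e * norm y"
      using b(2)[of "F *v y - F' *v y"] mult_left_mono[OF FF'[of y] \<open>0 \<le> b\<close>]
      by (simp add: norm_minus_commute mult.assoc)
    have "u - v = (A *v y - A' *v y) + (B *v (F *v y) - B' *v (F *v y)) + B' *v (F *v y - F' *v y)"
      by (simp add: u_def v_def matrix_vector_mult_diff_distrib)
    then have "norm (u - v) \<le> e' * norm y + e' * f * norm y + b * e * norm y"
      using 1 2 3 norm_triangle_ineq by (smt (verit))
    then show ?thesis by (simp add: d_def algebra_simps)
  qed
  have 1: "\<epsilon> * (norm y)\<^sup>2 \<le> y \<bullet> (S' *v y) - v \<bullet> (G *v v)"
  proof -
    define K where "K = A' + B' ** F'"
    have K: "K *v y = v"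
      by (simp add: K_def v_def matrix_vector_mult_add_rdistrib matrix_vector_mul_assoc)
    have "0 \<le> y \<bullet> ((S' - transpose K ** G ** K - \<epsilon> *\<^sub>R mat 1) *v y)"
      using ric by (simp add: psd_def K_def)
    also have "\<dots> = y \<bullet> (S' *v y) - y \<bullet> (transpose K *v (G *v (K *v y))) - \<epsilon> * (norm y)\<^sup>2"
      by (simp add: matrix_vector_mult_diff_rdistrib inner_diff_right matrix_vector_mul_assoc
          scaleR_matrix_vector_assoc[symmetric] power2_norm_eq_inner matrix_mul_assoc
          del: transpose_matrix_vector)
    finally show ?thesis by (simp only: inner_transpose_mult K)
  qed
  have 4: "(\<Sum>j<N. w j * (v \<bullet> (S j *v v))) - (\<Sum>j<N. w' j * (v \<bullet> (S j *v v)))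
      \<le> 2 * e' * (s * (norm v)\<^sup>2)"
  proof -
    have "(\<Sum>j<N. w j * (v \<bullet> (S j *v v))) - (\<Sum>j<N. w' j * (v \<bullet> (S j *v v)))
        = (\<Sum>j<N. (w j - w' j) * (v \<bullet> (S j *v v)))"
      by (simp add: sum_subtractf left_diff_distrib)
    also have "\<dots> \<le> (\<Sum>j<N. \<bar>w j - w' j\<bar> * (s * (norm v)\<^sup>2))"
    proof (rule sum_mono)
      fix j assume "j \<in> {..<N}"
      then have "\<bar>v \<bullet> (S j *v v)\<bar> \<le> s * (norm v)\<^sup>2" using quad[of j v v] by (simp add: power2_eq_square)
      then have "\<bar>w j - w' j\<bar> * \<bar>v \<bullet> (S j *v v)\<bar> \<le> \<bar>w j - w' j\<bar> * (s * (norm v)\<^sup>2)"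
        by (intro mult_left_mono) auto
      then show "(w j - w' j) * (v \<bullet> (S j *v v)) \<le> \<bar>w j - w' j\<bar> * (s * (norm v)\<^sup>2)"
        by (metis abs_le_D1 abs_mult)
    qed
    also have "\<dots> = (\<Sum>j<N. \<bar>w j - w' j\<bar>) * (s * (norm v)\<^sup>2)" by (simp add: sum_distrib_right)
    also have "\<dots> \<le> 2 * e' * (s * (norm v)\<^sup>2)"
      by (intro mult_right_mono ww') (simp add: nonneg)
    finally show ?thesis .
  qed
  have 5: "(\<Sum>j<N. w j * (u \<bullet> (S j *v u))) - (\<Sum>j<N. w j * (v \<bullet> (S j *v v)))
      \<le> 2 * s * k * d * (norm y)\<^sup>2"
  proof -
    have le: "u \<bullet> (S j *v u) - v \<bullet> (S j *v v) \<le> 2 * s * k * d * (norm y)\<^sup>2" if "j < N" for j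
    proof -
      have "transpose (S j) = S j" using S(1)[OF that] by (simp add: posdef_def)
      then have "u \<bullet> (S j *v u) - v \<bullet> (S j *v v) = (u - v) \<bullet> (S j *v (u + v))"
        using symmetric_form_commute[of "S j" u v]
        by (simp add: matrix_vector_right_distrib inner_diff_left inner_add_right)
      also have "\<dots> \<le> s * (norm (u - v) * norm (u + v))"
        using quad[OF that, of "u - v" "u + v"] by linarith
      also have "\<dots> \<le> s * ((d * norm y) * (2 * k * norm y))"
      proof (intro mult_left_mono mult_mono uv nonneg)
        show "norm (u + v) \<le> 2 * k * norm y" using u v norm_triangle_ineq[of u v] by simp
        show "0 \<le> d * norm y" using uv norm_ge_zero order_trans by blast
      qed simp
      finally show ?thesis by (simp add: power2_eq_square mult_ac)
    qed
    have "(\<Sum>j<N. w j * (u \<bullet> (S j *v u))) - (\<Sum>j<N. w j * (v \<bullet> (S j *v v)))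
        = (\<Sum>j<N. w j * (u \<bullet> (S j *v u) - v \<bullet> (S j *v v)))"
      by (simp add: sum_subtractf right_diff_distrib)
    also have "\<dots> \<le> (\<Sum>j<N. w j * (2 * s * k * d * (norm y)\<^sup>2))"
      by (intro sum_mono mult_left_mono le w) auto
    also have "\<dots> = (\<Sum>j<N. w j) * (2 * s * k * d * (norm y)\<^sup>2)" by (simp add: sum_distrib_right)
    also have "\<dots> \<le> 1 * (2 * s * k * d * (norm y)\<^sup>2)"
      by (intro mult_right_mono w) (use nonneg \<open>k \<ge> 0\<close> in \<open>simp add: d_def\<close>)
    finally show ?thesis by simp
  qed
  have "e * (norm v)\<^sup>2 + 2 * e' * (s * (norm v)\<^sup>2)
      \<le> e * (k\<^sup>2 * (norm y)\<^sup>2) + 2 * e' * (s * (k\<^sup>2 * (norm y)\<^sup>2))"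
    by (intro add_mono mult_left_mono v2) (simp_all add: nonneg)
  moreover have "(\<eta> + e * (1 + k\<^sup>2 + 2 * s * k * b) + e' * (2 * s * k\<^sup>2 + 2 * s * k * (1 + f))) * (norm y)\<^sup>2
      \<le> \<epsilon> * (norm y)\<^sup>2"
    using small unfolding k_def by (intro mult_right_mono) auto
  ultimately have "\<eta> * (norm y)\<^sup>2 + (\<Sum>j<N. w j * (u \<bullet> (S j *v u))) \<le> y \<bullet> (S i *v y)"
    using 1 4 5 G[of v] SS'[of y] by (simp add: d_def algebra_simps)
  then show ?thesis by (simp add: u_def)
qed

section \<open>Measure-theoretic ingredients\<close>

lemma is_box_borel: "is_box S \<Longrightarrow> S \<in> sets borel" for S :: "(real^'p) set"
proof -
  assume "is_box S"
  then obtain J where J: "\<And>k. is_interval (J k)" and S: "S = (\<Inter>k. (\<lambda>\<phi>. \<phi> $ k) -` J k)"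
    unfolding is_box_def by auto
  have "(\<lambda>\<phi>. \<phi> $ k) -` J k \<in> sets borel" for k
  proof -
    have "(\<lambda>\<phi> :: real^'p. \<phi> $ k) \<in> borel_measurable borel" by simp
    then have "(\<lambda>\<phi> :: real^'p. \<phi> $ k) -` J k \<inter> space borel \<in> sets borel"
      by (rule measurable_sets) (rule real_interval_borel_measurable[OF J])
    then show ?thesis by simp
  qed
  then show ?thesis unfolding S by (intro sets.countable_INT') auto
qed

lemma compact_param_space: "compact (param_space a b :: (real^'p) set)"
proof -
  have "(param_space a b :: (real^'p) set) = cbox (\<chi> k. a) (\<chi> k. b)"
    by (auto simp: param_space_def mem_box_cart)
  then show ?thesis by simp
qed

lemma bounded_mult_on_compact:
  fixes A :: "'a::metric_space \<Rightarrow> real^'m^'n"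
  assumes "compact M" "continuous_on M A"
  obtains a where "0 \<le> a" "\<And>\<phi> v. \<phi> \<in> M \<Longrightarrow> norm (A \<phi> *v v) \<le> a * norm v"
proof -
  have "bounded (A ` M)" using assms by (intro compact_imp_bounded compact_continuous_image)
  then obtain a where "0 < a" and a: "\<And>\<phi>. \<phi> \<in> M \<Longrightarrow> norm (A \<phi>) \<le> a"
    unfolding bounded_pos by blast
  show thesis
  proof (rule that[of a])
    show "norm (A \<phi> *v v) \<le> a * norm v" if "\<phi> \<in> M" for \<phi> v
      using norm_matrix_vector_le[of "A \<phi>" v] mult_right_mono[OF a[OF that], of "norm v"] by simp
  qed (use \<open>0 < a\<close> in simp)
qed

lemma AE_mnorm_le:
  assumes "sup_norm \<mu> P < ereal e"
  shows "AE \<phi> in \<mu>. \<forall>v. norm (P \<phi> *v v) \<le> e * norm v"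
proof -
  have "AE \<phi> in \<mu>. ereal (mnorm (P \<phi>)) \<le> sup_norm \<mu> P"
    unfolding sup_norm_def by (rule esssup_AE)
  then show ?thesis
  proof (rule eventually_mono, intro allI)
    fix \<phi> v assume "ereal (mnorm (P \<phi>)) \<le> sup_norm \<mu> P"
    then have "mnorm (P \<phi>) \<le> e" using assms by (metis ereal_less_eq(3) le_less_trans less_imp_le)
    then show "norm (P \<phi> *v v) \<le> e * norm v"
      using norm_le_mnorm[of "P \<phi>" v] mult_right_mono[of "mnorm (P \<phi>)" e "norm v"] by simp
  qed
qed

lemma Hsup_AE_bound:
  assumes "P \<in> Hsup \<mu>"
  obtains s where "0 \<le> s" "AE \<phi> in \<mu>. mnorm (P \<phi>) \<le> s"
proof -
  have "sup_norm \<mu> P < \<infinity>" using assms by (simp add: Hsup_def)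
  then obtain s where s: "sup_norm \<mu> P \<le> ereal s"
    by (cases "sup_norm \<mu> P") auto
  have "AE \<phi> in \<mu>. ereal (mnorm (P \<phi>)) \<le> sup_norm \<mu> P"
    unfolding sup_norm_def by (rule esssup_AE)
  then have "AE \<phi> in \<mu>. mnorm (P \<phi>) \<le> max s 0"
  proof (rule eventually_mono)
    fix \<phi> assume "ereal (mnorm (P \<phi>)) \<le> sup_norm \<mu> P"
    also note s
    finally show "mnorm (P \<phi>) \<le> max s 0" by simp
  qed
  then show thesis by (rule that[rotated]) simp
qed

lemma transition_density_point:
  assumes "transition_density \<mu> g" "\<phi> \<in> space \<mu>"
  shows transition_density_nonneg: "y \<in> space \<mu> \<Longrightarrow> 0 \<le> g \<phi> y"
    and transition_density_integrable: "integrable \<mu> (g \<phi>)"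
    and transition_density_integral: "(LINT y|\<mu>. g \<phi> y) = 1"
proof -
  show nonneg: "0 \<le> g \<phi> y" if "y \<in> space \<mu>" for y
    using assms that by (simp add: transition_density_def)
  have meas: "g \<phi> \<in> borel_measurable \<mu>"
    using assms by (simp add: transition_density_def)
  have "density \<mu> (\<lambda>y. ennreal (g \<phi> y)) \<in> space (prob_algebra \<mu>)"
    using assms unfolding transition_density_def by (blast dest: measurable_space)
  then interpret prob_space "density \<mu> (\<lambda>y. ennreal (g \<phi> y))"
    by (simp add: space_prob_algebra)
  have 1: "(\<integral>\<^sup>+y. ennreal (g \<phi> y) \<partial>\<mu>) = 1"
    using emeasure_space_1 meas
    by (simp add: emeasure_density cong: nn_integral_cong)
  have AE: "AE y in \<mu>. 0 \<le> g \<phi> y" using nonneg by (rule AE_I2)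
  show "integrable \<mu> (g \<phi>)"
    using meas AE 1 by (intro integrableI_nonneg) auto
  show "(LINT y|\<mu>. g \<phi> y) = 1"
    using integral_eq_nn_integral[OF meas AE] 1 by simp
qed

text \<open>A box of measure zero is never entered; this is what makes the data on such boxes irrelevant to
  all other boxes.\<close>

lemma box_prob_properties:
  assumes g: "transition_density \<mu> g" and \<phi>: "\<phi> \<in> space \<mu>"
    and \<B>: "\<And>j. j < N \<Longrightarrow> \<B> j \<in> sets \<mu>"
  shows box_prob_nonneg: "0 \<le> box_prob \<mu> g \<B> j \<phi>"
    and box_prob_null: "AE y in \<mu>. y \<notin> \<B> j \<Longrightarrow> box_prob \<mu> g \<B> j \<phi> = 0"
    and sum_box_prob: "disjoint_family_on \<B> {..<N} \<Longrightarrow> (\<Union>j<N. \<B> j) = space \<mu>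
      \<Longrightarrow> (\<Sum>j<N. box_prob \<mu> g \<B> j \<phi>) = 1"
    and box_prob_integrable: "j < N \<Longrightarrow> integrable \<mu> (\<lambda>y. indicator (\<B> j) y * g \<phi> y)"
proof -
  have int: "integrable \<mu> (g \<phi>)" by (rule transition_density_integrable[OF g \<phi>])
  show "0 \<le> box_prob \<mu> g \<B> j \<phi>"
    unfolding box_prob_def set_lebesgue_integral_def
    by (rule integral_nonneg_AE, rule AE_I2) (simp add: transition_density_nonneg[OF g \<phi>])
  show "box_prob \<mu> g \<B> j \<phi> = 0" if "AE y in \<mu>. y \<notin> \<B> j"
    unfolding box_prob_def set_lebesgue_integral_def
    by (rule integral_eq_zero_AE, use that in eventually_elim) simp
  show 1: "integrable \<mu> (\<lambda>y. indicator (\<B> j) y * g \<phi> y)" if "j < N" for j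
    using integrable_mult_indicator[OF \<B>[OF that] int] by simp
  show "(\<Sum>j<N. box_prob \<mu> g \<B> j \<phi>) = 1"
    if disj: "disjoint_family_on \<B> {..<N}" and un: "(\<Union>j<N. \<B> j) = space \<mu>"
  proof -
    have "(\<Sum>j<N. box_prob \<mu> g \<B> j \<phi>) = (LINT y|\<mu>. (\<Sum>j<N. indicator (\<B> j) y * g \<phi> y))"
      unfolding box_prob_def set_lebesgue_integral_def
      using 1 by (subst Bochner_Integration.integral_sum) auto
    also have "\<dots> = (LINT y|\<mu>. g \<phi> y)"
    proof (rule Bochner_Integration.integral_cong)
      fix y assume "y \<in> space \<mu>"
      then have "indicator (\<Union>j<N. \<B> j) y = (1::real)" by (simp add: un)
      moreover have "indicator (\<Union>j<N. \<B> j) y = (\<Sum>j<N. indicator (\<B> j) y :: real)"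
        by (rule indicator_UN_disjoint[OF finite_lessThan disj])
      ultimately have "(\<Sum>j<N. indicator (\<B> j) y) = (1::real)" by simp
      then show "(\<Sum>j<N. indicator (\<B> j) y * g \<phi> y) = g \<phi> y" by (simp flip: sum_distrib_right)
    qed simp
    finally show ?thesis by (simp add: transition_density_integral[OF g \<phi>])
  qed
qed

text \<open>The step function takes the value \<open>T j\<close> on the \<open>j\<close>-th box, so the sum on the left is its
  expectation after one transition.  Working with the quadratic form at a fixed \<open>v\<close> reduces a comparison
  of matrix-valued integrals to the monotonicity of real ones.\<close>

lemma expectation_ge_step_function:
  fixes S :: "'a \<Rightarrow> real^'n^'n" and T :: "nat \<Rightarrow> real^'n^'n"
  assumes g: "transition_density \<mu> g" and \<phi>: "\<phi> \<in> space \<mu>"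
    and \<B>: "\<And>j. j < N \<Longrightarrow> \<B> j \<in> sets \<mu>" "disjoint_family_on \<B> {..<N}" "(\<Union>j<N. \<B> j) = space \<mu>"
    and S: "S \<in> Hsup \<mu>"
    and le: "\<And>j. j < N \<Longrightarrow> AE y in \<mu>. y \<in> \<B> j \<longrightarrow> v \<bullet> (T j *v v) \<le> v \<bullet> (S y *v v) + e * (norm v)\<^sup>2"
  shows "(\<Sum>j<N. box_prob \<mu> g \<B> j \<phi> * (v \<bullet> (T j *v v)))
    \<le> v \<bullet> ((LINT y|\<mu>. g \<phi> y *\<^sub>R S y) *v v) + e * (norm v)\<^sup>2"
proof -
  have int: "integrable \<mu> (g \<phi>)" by (rule transition_density_integrable[OF g \<phi>])
  have Smeas[measurable]: "S \<in> borel_measurable \<mu>" using S by (simp add: Hsup_def)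
  have gmeas[measurable]: "g \<phi> \<in> borel_measurable \<mu>" using int by simp
  obtain s where "0 \<le> s" and s: "AE y in \<mu>. mnorm (S y) \<le> s" using Hsup_AE_bound[OF S] .
  \<comment> \<open>A non-integrable integrand would have integral 0 by convention, so integrability of \<open>g S\<close> is a
    real obligation; it follows from the essential bound on \<open>S\<close>.\<close>
  have intS: "integrable \<mu> (\<lambda>y. g \<phi> y *\<^sub>R S y)"
  proof (rule Bochner_Integration.integrable_bound)
    let ?C = "real (CARD('n) * CARD('n)) * s"
    show "integrable \<mu> (\<lambda>y. ?C * g \<phi> y)" using int by simp
    show "(\<lambda>y. g \<phi> y *\<^sub>R S y) \<in> borel_measurable \<mu>" by measurable
    show "AE y in \<mu>. norm (g \<phi> y *\<^sub>R S y) \<le> norm (?C * g \<phi> y)"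
      using s
    proof eventually_elim
      fix y assume "mnorm (S y) \<le> s"
      then have "norm (S y) \<le> ?C"
        using norm_le_card_mnorm[of "S y"] by (smt (verit) mult_left_mono of_nat_0_le_iff)
      then have "\<bar>g \<phi> y\<bar> * norm (S y) \<le> \<bar>g \<phi> y\<bar> * ?C" by (intro mult_left_mono) auto
      then show "norm (g \<phi> y *\<^sub>R S y) \<le> norm (?C * g \<phi> y)"
        using \<open>0 \<le> s\<close> by (simp add: abs_mult mult_ac)
    qed
  qed
  have lin: "bounded_linear (\<lambda>X :: real^'n^'n. v \<bullet> (X *v v))"
    by (intro linear_conv_bounded_linear[THEN iffD1] linearI)
      (simp_all add: matrix_vector_mult_add_rdistrib inner_add_right scaleR_matrix_vector_assoc[symmetric])
  have q: "integrable \<mu> (\<lambda>y. g \<phi> y * (v \<bullet> (S y *v v)))"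
    "(LINT y|\<mu>. g \<phi> y * (v \<bullet> (S y *v v))) = v \<bullet> ((LINT y|\<mu>. g \<phi> y *\<^sub>R S y) *v v)"
    using integrable_bounded_linear[OF lin intS] integral_bounded_linear[OF lin intS]
    by (simp_all add: scaleR_matrix_vector_assoc[symmetric])
  have box: "integrable \<mu> (\<lambda>y. indicator (\<B> j) y * g \<phi> y)" if "j < N" for j
    by (rule box_prob_integrable[where N = N, OF g \<phi>]) (use \<B>(1) that in auto)
  have "(\<Sum>j<N. box_prob \<mu> g \<B> j \<phi> * (v \<bullet> (T j *v v)))
      = (LINT y|\<mu>. (\<Sum>j<N. indicator (\<B> j) y * g \<phi> y * (v \<bullet> (T j *v v))))"
    unfolding box_prob_def set_lebesgue_integral_def
    using box by (subst Bochner_Integration.integral_sum) auto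
  also have "\<dots> \<le> (LINT y|\<mu>. g \<phi> y * (v \<bullet> (S y *v v)) + e * (norm v)\<^sup>2 * g \<phi> y)"
  proof (rule integral_mono_AE)
    show "integrable \<mu> (\<lambda>y. \<Sum>j<N. indicator (\<B> j) y * g \<phi> y * (v \<bullet> (T j *v v)))"
      using box by auto
    show "integrable \<mu> (\<lambda>y. g \<phi> y * (v \<bullet> (S y *v v)) + e * (norm v)\<^sup>2 * g \<phi> y)"
      using q(1) int by auto
    have "AE y in \<mu>. \<forall>j\<in>{..<N}. y \<in> \<B> j \<longrightarrow> v \<bullet> (T j *v v) \<le> v \<bullet> (S y *v v) + e * (norm v)\<^sup>2"
      using le by (intro AE_finite_allI) auto
    moreover have "AE y in \<mu>. y \<in> space \<mu>" by (rule AE_space)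
    ultimately show "AE y in \<mu>. (\<Sum>j<N. indicator (\<B> j) y * g \<phi> y * (v \<bullet> (T j *v v)))
        \<le> g \<phi> y * (v \<bullet> (S y *v v)) + e * (norm v)\<^sup>2 * g \<phi> y"
    proof eventually_elim
      fix y assume *: "\<forall>j\<in>{..<N}. y \<in> \<B> j \<longrightarrow> v \<bullet> (T j *v v) \<le> v \<bullet> (S y *v v) + e * (norm v)\<^sup>2"
        and y: "y \<in> space \<mu>"
      then obtain j where j: "j < N" "y \<in> \<B> j" using \<B>(3) by auto
      have "indicator (\<B> k) y = (if k = j then 1 else 0 :: real)" if "k < N" for k
        using \<B>(2) j that by (auto simp: disjoint_family_on_def indicator_def)
      then have "(\<Sum>j<N. indicator (\<B> j) y * g \<phi> y * (v \<bullet> (T j *v v)))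
          = (\<Sum>k<N. if k = j then g \<phi> y * (v \<bullet> (T k *v v)) else 0)"
        by (intro sum.cong refl) auto
      also have "\<dots> = g \<phi> y * (v \<bullet> (T j *v v))" using j by simp
      also have "\<dots> \<le> g \<phi> y * (v \<bullet> (S y *v v) + e * (norm v)\<^sup>2)"
        using * j by (intro mult_left_mono transition_density_nonneg[OF g \<phi> y]) auto
      finally show "(\<Sum>j<N. indicator (\<B> j) y * g \<phi> y * (v \<bullet> (T j *v v)))
        \<le> g \<phi> y * (v \<bullet> (S y *v v)) + e * (norm v)\<^sup>2 * g \<phi> y" by (simp add: algebra_simps)
    qed
  qed
  also have "\<dots> = v \<bullet> ((LINT y|\<mu>. g \<phi> y *\<^sub>R S y) *v v) + e * (norm v)\<^sup>2"
    using q int by (simp add: transition_density_integral[OF g \<phi>])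
  finally show ?thesis .
qed

section \<open>Norms of stacked and concatenated matrices\<close>

lemma stacked_mnorm_le:
  assumes "\<And>x. L2_set (\<lambda>j. norm (X j *v x)) {..<N} \<le> k * norm x" "0 \<le> k"
  shows "stacked_mnorm N X \<le> k"
  unfolding stacked_mnorm_def
proof (rule cSUP_least)
  fix x
  show "L2_set (\<lambda>j. norm (X j *v x)) {..<N} / norm x \<le> k"
    using assms by (cases "x = 0") (simp_all add: divide_le_eq)
qed simp

text \<open>The bound \<open>\<kappa>\<close> on the uncertainty: writing
  \<open>\<surd>p X - \<surd>q Y = \<surd>p (X - Y) + (\<surd>p - \<surd>q) Y\<close>, each summand has a factor of size \<open>e\<close>, while the
  stack of the \<open>\<surd>p\<close> has norm at most 1.  Thus \<open>\<kappa>\<close> is proportional to \<open>e\<close>, whatever \<open>N\<close> is.\<close>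

lemma stacked_mnorm_weighted_le:
  assumes p: "\<And>j. j < N \<Longrightarrow> 0 \<le> p j" "(\<Sum>j<N. p j) \<le> 1"
    and pq: "L2_set (\<lambda>j. sqrt (p j) - sqrt (q j)) {..<N} \<le> e"
    and X: "\<And>x. norm ((X - Y) *v x) \<le> e * norm x" and Y: "\<And>x. norm (Y *v x) \<le> k * norm x"
    and nonneg: "0 \<le> e" "0 \<le> k"
  shows "stacked_mnorm N (\<lambda>j. sqrt (p j) *\<^sub>R X - sqrt (q j) *\<^sub>R Y) \<le> e * (1 + k)"
proof (rule stacked_mnorm_le)
  fix x
  let ?d = "\<lambda>j. sqrt (p j) - sqrt (q j)"
  have split: "norm ((sqrt (p j) *\<^sub>R X - sqrt (q j) *\<^sub>R Y) *v x)
      \<le> sqrt (p j) * (e * norm x) + \<bar>?d j\<bar> * (k * norm x)" if "j < N" for j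
  proof -
    have "(sqrt (p j) *\<^sub>R X - sqrt (q j) *\<^sub>R Y) *v x
        = sqrt (p j) *\<^sub>R ((X - Y) *v x) + ?d j *\<^sub>R (Y *v x)"
      by (simp add: matrix_vector_mult_diff_rdistrib scaleR_matrix_vector_assoc[symmetric] algebra_simps)
    also have "norm \<dots> \<le> norm (sqrt (p j) *\<^sub>R ((X - Y) *v x)) + norm (?d j *\<^sub>R (Y *v x))"
      by (rule norm_triangle_ineq)
    also have "\<dots> \<le> sqrt (p j) * (e * norm x) + \<bar>?d j\<bar> * (k * norm x)"
      using p(1)[OF that] by (auto intro!: add_mono mult_left_mono X Y)
    finally show ?thesis .
  qed
  have "L2_set (\<lambda>j. norm ((sqrt (p j) *\<^sub>R X - sqrt (q j) *\<^sub>R Y) *v x)) {..<N}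
      \<le> L2_set (\<lambda>j. sqrt (p j) * (e * norm x) + \<bar>?d j\<bar> * (k * norm x)) {..<N}"
    by (intro L2_set_mono split) auto
  also have "\<dots> \<le> L2_set (\<lambda>j. sqrt (p j) * (e * norm x)) {..<N}
      + L2_set (\<lambda>j. \<bar>?d j\<bar> * (k * norm x)) {..<N}"
    by (rule L2_set_triangle_ineq)
  also have "\<dots> = L2_set (\<lambda>j. sqrt (p j)) {..<N} * (e * norm x) + L2_set ?d {..<N} * (k * norm x)"
    using nonneg by (simp add: L2_set_left_distrib) (simp add: L2_set_def power_mult_distrib)
  also have "\<dots> \<le> 1 * (e * norm x) + e * (k * norm x)"
    using p nonneg by (intro add_mono mult_right_mono pq) (simp_all add: L2_set_def)
  finally show "L2_set (\<lambda>j. norm ((sqrt (p j) *\<^sub>R X - sqrt (q j) *\<^sub>R Y) *v x)) {..<N}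
      \<le> e * (1 + k) * norm x" by (simp add: algebra_simps)
qed (use nonneg in simp)

lemma hcat_mult_le:
  assumes "\<And>v. norm (X *v v) \<le> a * norm v" "\<And>v. norm (Y *v v) \<le> b * norm v" "0 \<le> a" "0 \<le> b"
  shows "norm (hcat X Y *v x) \<le> (a + b) * norm x"
proof -
  obtain y z where x: "x = vcat y z" by (rule vcat_cases)
  have "norm (hcat X Y *v x) \<le> norm (X *v y) + norm (Y *v z)"
    by (simp add: x hcat_mult_vcat norm_triangle_ineq)
  also have "\<dots> \<le> a * norm x + b * norm x"
    unfolding x using assms norm_le_norm_vcat(1)[of y z] norm_le_norm_vcat(2)[of z y]
    by (intro add_mono order_trans[OF assms(1)] order_trans[OF assms(2)] mult_left_mono)
  finally show ?thesis by (simp add: algebra_simps)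
qed

lemma hcat_diff: "hcat X Y - hcat X' Y' = hcat (X - X') (Y - Y')"
  by (auto simp: vec_eq_iff hcat_def split: sum.split)

lemma hcat_scaleR: "hcat (r *\<^sub>R X) (r *\<^sub>R Y) = r *\<^sub>R hcat X Y"
  by (auto simp: vec_eq_iff hcat_def split: sum.split)

lemma block_norms_le_hcat:
  assumes "mnorm (hcat X Y) \<le> e"
  shows "norm (X *v v) \<le> e * norm v" "norm (Y *v u) \<le> e * norm u"
proof -
  have le: "norm (hcat X Y *v x) \<le> e * norm x" for x
    using norm_le_mnorm[of "hcat X Y" x] mult_right_mono[OF assms, of "norm x"] by simp
  have "norm (vcat v (0 :: real^'b)) = norm v" "norm (vcat (0 :: real^'a) u) = norm u"
    for v :: "real^'a" and u :: "real^'b"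
    by (rule power2_eq_imp_eq; simp add: norm_vcat)+
  then show "norm (X *v v) \<le> e * norm v" "norm (Y *v u) \<le> e * norm u"
    using le[of "vcat v 0"] le[of "vcat 0 u"] by (simp_all add: hcat_mult_vcat)
qed

section \<open>Feasibility of the linear matrix inequalities\<close>

theorem proposition5p7:
  fixes \<tau>min \<tau>max :: real
    and M :: "(real^'p) set"
    and \<mu> :: "(real^'p) measure"
    and g :: "real^'p \<Rightarrow> real^'p \<Rightarrow> real"
    and A :: "real^'p \<Rightarrow> real^'n^'n"
    and B :: "real^'p \<Rightarrow> real^'m^'n"
  assumes "\<tau>min \<le> \<tau>max"
    and M_def: "M = param_space \<tau>min \<tau>max"
    and "sets \<mu> = sets (restrict_space borel M)"
    and "sigma_finite_measure \<mu>"
    and "transition_density \<mu> g"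
    and "A \<in> Hsup \<mu>"
    and "B \<in> Hsup \<mu>"
    and I: "\<And>c \<delta>. c \<in> M \<Longrightarrow> \<delta> > 0 \<Longrightarrow> emeasure \<mu> {\<phi> \<in> M. norm (\<phi> - c) < \<delta>} > 0"
    and II: "continuous_on M A" "continuous_on M B"
    and III: "\<exists>(S :: real^'p \<Rightarrow> real^'n^'n) (F :: real^'p \<Rightarrow> real^'n^'m) (\<epsilon> :: real).
      S \<in> Hsup_plus \<mu> \<and> F \<in> Hsup \<mu> \<and> \<epsilon> > 0 \<and>
      (AE \<phi> in \<mu>. psd (S \<phi> - transpose (A \<phi> + B \<phi> ** F \<phi>) ** (LINT y|\<mu>. g \<phi> y *\<^sub>R S y)
          ** (A \<phi> + B \<phi> ** F \<phi>) - \<epsilon> *\<^sub>R mat 1)) \<and>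
      (\<forall>\<epsilon>a>0. \<forall>\<epsilon>b>0. \<exists>N \<B> c (Sa :: real^'p \<Rightarrow> real^'n^'n) (Fa :: real^'p \<Rightarrow> real^'n^'m) Si Fi.
        box_partition M N \<B> \<and> (\<forall>i<N. c i \<in> \<B> i) \<and>
        Sa \<in> Hsup_plus \<mu> \<and> Fa \<in> Hsup \<mu> \<and>
        (\<forall>i<N. posdef (Si i) \<and> (\<forall>\<phi>\<in>\<B> i. Sa \<phi> = Si i \<and> Fa \<phi> = Fi i)) \<and>
        sup_norm \<mu> (\<lambda>\<phi>. S \<phi> - Sa \<phi>) < ereal \<epsilon>a \<and>
        sup_norm \<mu> (\<lambda>\<phi>. F \<phi> - Fa \<phi>) < ereal \<epsilon>a \<and>
        (\<forall>i<N. \<forall>j<N. continuous (at (c i) within M) (box_prob \<mu> g \<B> j)) \<and>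
        (\<forall>i<N. AE \<phi> in \<mu>. \<phi> \<in> \<B> i \<longrightarrow>
          mnorm (hcat (A \<phi>) (B \<phi>) - hcat (A (c i)) (B (c i))) < \<epsilon>b \<and>
          L2_set (\<lambda>j. sqrt (box_prob \<mu> g \<B> j \<phi>) - sqrt (box_prob \<mu> g \<B> j (c i))) {..<N} < \<epsilon>b))"
  shows "\<exists>N \<B> c \<kappa> \<Gamma>A \<Gamma>B.
    box_partition M N \<B> \<and> (\<forall>i<N. c i \<in> \<B> i \<and> \<kappa> i > 0) \<and>
    (\<forall>i j. \<Gamma>A i j = sqrt (box_prob \<mu> g \<B> j (c i)) *\<^sub>R A (c i) \<and>
           \<Gamma>B i j = sqrt (box_prob \<mu> g \<B> j (c i)) *\<^sub>R B (c i)) \<and>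
    (\<forall>i<N. AE \<phi> in \<mu>. \<phi> \<in> \<B> i \<longrightarrow>
      stacked_mnorm N (\<lambda>j. hcat (sqrt (box_prob \<mu> g \<B> j \<phi>) *\<^sub>R A \<phi>) (sqrt (box_prob \<mu> g \<B> j \<phi>) *\<^sub>R B \<phi>)
        - hcat (\<Gamma>A i j) (\<Gamma>B i j)) \<le> \<kappa> i) \<and>
    (\<exists>(R :: nat \<Rightarrow> real^'n^'n) (U :: nat \<Rightarrow> real^'n^'n) (Fb :: nat \<Rightarrow> real^'n^'m) (l :: nat \<Rightarrow> real).
      \<forall>i<N. posdef (R i) \<and> l i > 0 \<and>
        posdef_on (lmi_indices N) (lmi_matrix i (\<Gamma>A i) (\<Gamma>B i) (\<kappa> i) R (U i) (Fb i) (l i)))"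
proof -
  have space: "space \<mu> = M"
    using sets_eq_imp_space_eq[OF assms(3)] by (simp add: space_restrict_space)
  have "compact M" unfolding M_def by (rule compact_param_space)
  obtain a where a: "0 \<le> a" "\<And>\<phi> v. \<phi> \<in> M \<Longrightarrow> norm (A \<phi> *v v) \<le> a * norm v"
    using bounded_mult_on_compact[OF \<open>compact M\<close> II(1)] by blast
  obtain b where b: "0 \<le> b" "\<And>\<phi> v. \<phi> \<in> M \<Longrightarrow> norm (B \<phi> *v v) \<le> b * norm v"
    using bounded_mult_on_compact[OF \<open>compact M\<close> II(2)] by blast
  obtain S :: "real^'p \<Rightarrow> real^'n^'n" and F :: "real^'p \<Rightarrow> real^'n^'m" and \<epsilon>
    where S: "S \<in> Hsup_plus \<mu>" and F: "F \<in> Hsup \<mu>" and "\<epsilon> > 0"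
      and ric: "AE \<phi> in \<mu>. psd (S \<phi> - transpose (A \<phi> + B \<phi> ** F \<phi>) ** (LINT y|\<mu>. g \<phi> y *\<^sub>R S y)
          ** (A \<phi> + B \<phi> ** F \<phi>) - \<epsilon> *\<^sub>R mat 1)"
      and approx: "\<forall>\<epsilon>a>0. \<forall>\<epsilon>b>0. \<exists>N \<B> c (Sa :: real^'p \<Rightarrow> real^'n^'n) (Fa :: real^'p \<Rightarrow> real^'n^'m) Si Fi.
        box_partition M N \<B> \<and> (\<forall>i<N. c i \<in> \<B> i) \<and>
        Sa \<in> Hsup_plus \<mu> \<and> Fa \<in> Hsup \<mu> \<and>
        (\<forall>i<N. posdef (Si i) \<and> (\<forall>\<phi>\<in>\<B> i. Sa \<phi> = Si i \<and> Fa \<phi> = Fi i)) \<and>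
        sup_norm \<mu> (\<lambda>\<phi>. S \<phi> - Sa \<phi>) < ereal \<epsilon>a \<and>
        sup_norm \<mu> (\<lambda>\<phi>. F \<phi> - Fa \<phi>) < ereal \<epsilon>a \<and>
        (\<forall>i<N. \<forall>j<N. continuous (at (c i) within M) (box_prob \<mu> g \<B> j)) \<and>
        (\<forall>i<N. AE \<phi> in \<mu>. \<phi> \<in> \<B> i \<longrightarrow>
          mnorm (hcat (A \<phi>) (B \<phi>) - hcat (A (c i)) (B (c i))) < \<epsilon>b \<and>
          L2_set (\<lambda>j. sqrt (box_prob \<mu> g \<B> j \<phi>) - sqrt (box_prob \<mu> g \<B> j (c i))) {..<N} < \<epsilon>b)"
    using III by blast
  have SH: "S \<in> Hsup \<mu>" using S by (simp add: Hsup_plus_def)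
  obtain s\<^sub>0 where s\<^sub>0: "0 \<le> s\<^sub>0" "AE \<phi> in \<mu>. mnorm (S \<phi>) \<le> s\<^sub>0" using Hsup_AE_bound[OF SH] by blast
  obtain f\<^sub>0 where f\<^sub>0: "0 \<le> f\<^sub>0" "AE \<phi> in \<mu>. mnorm (F \<phi>) \<le> f\<^sub>0" using Hsup_AE_bound[OF F] by blast

  \<comment> \<open>\<open>L I\<close> replaces \<open>S i\<close> on boxes of measure zero.  With zero gain there, the Riccati inequality
    needs \<open>L\<close> to exceed \<open>a\<^sup>2\<close> times the bound \<open>s\<^sub>0 + 1\<close> on the other values.  \<open>p\<close> and \<open>q\<close> are the
    loss rates in \<open>riccati_perturbation\<close>, and \<open>\<epsilon>b C\<close> will be \<open>\<kappa>\<close>.  None of these constants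
    depends on the partition, which is obtained only afterwards.\<close>
  define L where "L = (s\<^sub>0 + 1) * a\<^sup>2 + \<epsilon>"
  define s where "s = (s\<^sub>0 + 1) + L"
  define f where "f = f\<^sub>0 + 1"
  define k where "k = a + b * f"
  define \<eta> where "\<eta> = \<epsilon> / 2"
  define l where "l = \<eta> / (2 * s * (\<eta> + 4 * s))"
  define p where "p = 1 + k\<^sup>2 + 2 * s * k * b"
  define q where "q = 2 * s * k\<^sup>2 + 2 * s * k * (1 + f)"
  define C where "C = 1 + (a + b)"
  define \<epsilon>a where "\<epsilon>a = min 1 (\<epsilon> / (4 * p))"
  define \<epsilon>b where "\<epsilon>b = min (\<epsilon> / (4 * (q + 1))) (sqrt (\<eta> * l / (8 * C\<^sup>2 * (1 + f\<^sup>2))))"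
  have "L > 0" using \<open>\<epsilon> > 0\<close> s\<^sub>0(1) by (simp add: L_def add_nonneg_pos)
  have "s > 0" using \<open>L > 0\<close> s\<^sub>0(1) by (simp add: s_def)
  have "f \<ge> 0" using f\<^sub>0 by (simp add: f_def)
  have "k \<ge> 0" using a(1) b(1) \<open>f \<ge> 0\<close> by (simp add: k_def)
  have "\<eta> > 0" using \<open>\<epsilon> > 0\<close> by (simp add: \<eta>_def)
  have "l > 0" using \<open>s > 0\<close> \<open>\<eta> > 0\<close> by (simp add: l_def)
  have "p > 0" using \<open>s > 0\<close> \<open>k \<ge> 0\<close> b(1) by (simp add: p_def add_pos_nonneg)
  have "q \<ge> 0" using \<open>s > 0\<close> \<open>k \<ge> 0\<close> \<open>f \<ge> 0\<close> by (simp add: q_def)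
  have "C > 0" using a(1) b(1) by (simp add: C_def)
  have "\<epsilon>a > 0" "\<epsilon>a \<le> 1" using \<open>\<epsilon> > 0\<close> \<open>p > 0\<close> by (simp_all add: \<epsilon>a_def)
  have f1: "0 < 1 + f\<^sup>2" by (simp add: add_pos_nonneg)
  have "\<epsilon>b > 0" using \<open>\<epsilon> > 0\<close> \<open>q \<ge> 0\<close> \<open>\<eta> > 0\<close> \<open>l > 0\<close> \<open>C > 0\<close> f1 by (simp add: \<epsilon>b_def)
  have "\<epsilon>a * p \<le> \<epsilon> / 4"
  proof -
    have "\<epsilon>a \<le> \<epsilon> / (4 * p)" by (simp add: \<epsilon>a_def)
    then show ?thesis using \<open>p > 0\<close> by (simp add: field_simps)
  qed
  moreover have "\<epsilon>b * q \<le> \<epsilon> / 4"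
  proof -
    have "\<epsilon>b \<le> \<epsilon> / (4 * (q + 1))" by (simp add: \<epsilon>b_def)
    then have "\<epsilon>b * (q + 1) \<le> \<epsilon> / 4" using \<open>q \<ge> 0\<close> by (simp add: field_simps)
    then show ?thesis using \<open>\<epsilon>b > 0\<close> by (simp add: distrib_left)
  qed
  ultimately have small: "\<eta> + \<epsilon>a * p + \<epsilon>b * q \<le> \<epsilon>" by (simp add: \<eta>_def)
  have \<kappa>: "8 * (\<epsilon>b * C)\<^sup>2 * (1 + f\<^sup>2) \<le> \<eta> * l"
  proof -
    have "\<epsilon>b\<^sup>2 \<le> (sqrt (\<eta> * l / (8 * C\<^sup>2 * (1 + f\<^sup>2))))\<^sup>2"
      using \<open>\<epsilon>b > 0\<close> by (intro power_mono) (simp_all add: \<epsilon>b_def)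
    also have "\<dots> = \<eta> * l / (8 * C\<^sup>2 * (1 + f\<^sup>2))"
      using \<open>\<eta> > 0\<close> \<open>l > 0\<close> f1 by simp
    finally have "\<epsilon>b\<^sup>2 * (8 * C\<^sup>2 * (1 + f\<^sup>2)) \<le> \<eta> * l"
      using \<open>C > 0\<close> f1 by (simp add: pos_le_divide_eq)
    then show ?thesis by (simp add: power_mult_distrib mult_ac)
  qed

  obtain N \<B> c Sa Fa Si Fi
    where part: "box_partition M N \<B>" and centres: "\<forall>i<N. c i \<in> \<B> i"
      and "Sa \<in> Hsup_plus \<mu>" "Fa \<in> Hsup \<mu>"
      and pieces: "\<forall>i<N. posdef (Si i) \<and> (\<forall>\<phi>\<in>\<B> i. Sa \<phi> = Si i \<and> Fa \<phi> = Fi i)"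
      and SSa: "sup_norm \<mu> (\<lambda>\<phi>. S \<phi> - Sa \<phi>) < ereal \<epsilon>a"
      and FFa: "sup_norm \<mu> (\<lambda>\<phi>. F \<phi> - Fa \<phi>) < ereal \<epsilon>a"
      and "\<forall>i<N. \<forall>j<N. continuous (at (c i) within M) (box_prob \<mu> g \<B> j)"
      and close: "\<forall>i<N. AE \<phi> in \<mu>. \<phi> \<in> \<B> i \<longrightarrow>
          mnorm (hcat (A \<phi>) (B \<phi>) - hcat (A (c i)) (B (c i))) < \<epsilon>b \<and>
          L2_set (\<lambda>j. sqrt (box_prob \<mu> g \<B> j \<phi>) - sqrt (box_prob \<mu> g \<B> j (c i))) {..<N} < \<epsilon>b"
    using approx[rule_format, OF \<open>\<epsilon>a > 0\<close> \<open>\<epsilon>b > 0\<close>] by (elim exE conjE) (rule that)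
  have c: "c i \<in> \<B> i" and Si: "posdef (Si i)" if "i < N" for i
    using centres pieces that by auto
  have Sa: "Sa \<phi> = Si i" and Fa: "Fa \<phi> = Fi i" if "i < N" "\<phi> \<in> \<B> i" for i \<phi>
    using pieces that by auto
  note near = close[rule_format]
  define w where "w = box_prob \<mu> g \<B>"
  have disj: "disjoint_family_on \<B> {..<N}" and un: "(\<Union>j<N. \<B> j) = space \<mu>"
    using part by (simp_all add: box_partition_def space)
  have BM: "\<B> i \<subseteq> M" if "i < N" for i using un that space by blast
  have cM: "c i \<in> M" if "i < N" for i using c[OF that] BM[OF that] by blast
  have meas: "\<B> j \<in> sets \<mu>" if "j < N" for j
  proof -
    have "\<B> j \<in> sets borel" using part that by (simp add: box_partition_def is_box_borel)
    then have "M \<inter> \<B> j \<in> sets (restrict_space borel M)" by (auto simp: sets_restrict_space)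
    then show ?thesis using BM[OF that] assms(3) by (simp add: inf_absorb2)
  qed
  note g = assms(5)
  have w: "0 \<le> w j \<phi>" "(\<Sum>j<N. w j \<phi>) \<le> 1" if "\<phi> \<in> M" for j \<phi>
    unfolding w_def
    using box_prob_nonneg[OF g, of \<phi> N \<B> j] sum_box_prob[OF g, of \<phi> N \<B>] meas disj un that
    by (simp_all add: space)
  have SSa': "AE \<phi> in \<mu>. \<forall>v. norm ((S \<phi> - Sa \<phi>) *v v) \<le> \<epsilon>a * norm v" by (rule AE_mnorm_le[OF SSa])
  have FFa': "AE \<phi> in \<mu>. \<forall>v. norm ((F \<phi> - Fa \<phi>) *v v) \<le> \<epsilon>a * norm v" by (rule AE_mnorm_le[OF FFa])
  \<comment> \<open>The a.e. hypotheses say nothing about the values on null boxes, where they can be arbitrarily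
    large or small; they are replaced before any uniform bound is claimed.\<close>
  define null where "null = (\<lambda>j. AE \<phi> in \<mu>. \<phi> \<notin> \<B> j)"
  have w_null: "w j \<phi> = 0" if "null j" "\<phi> \<in> M" for j \<phi>
    unfolding w_def using box_prob_null[OF g, of \<phi> N \<B> j] meas that by (simp add: space null_def)
  \<comment> \<open>A box of positive measure contains a point at which all the a.e. properties hold at once; this
    is the typical point from which they are carried over to the centre.\<close>
  have pick: "\<exists>\<phi>\<in>\<B> j. \<phi> \<in> M \<and> P \<phi>" if "\<not> null j" "AE \<phi> in \<mu>. \<phi> \<in> \<B> j \<longrightarrow> P \<phi>" for j P
  proof (rule ccontr)
    assume no: "\<not> ?thesis"
    have "AE \<phi> in \<mu>. \<phi> \<notin> \<B> j"
      using that(2) AE_space by eventually_elim (use no space in auto)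
    with that(1) show False by (simp add: null_def)
  qed
  define T where "T = (\<lambda>j. if null j then L *\<^sub>R mat 1 else Si j)"
  define H where "H = (\<lambda>j. if null j then 0 else Fi j)"
  have T_pd: "posdef (T j)" if "j < N" for j
    using Si[OF that] \<open>L > 0\<close>
    by (simp add: T_def posdef_def transpose_scalar transpose_mat scaleR_matrix_vector_assoc[symmetric])
  have T_live: "norm (T j *v v) \<le> (s\<^sub>0 + 1) * norm v" if "j < N" "\<not> null j" for j v
  proof -
    have "AE \<phi> in \<mu>. \<phi> \<in> \<B> j \<longrightarrow> mnorm (S \<phi>) \<le> s\<^sub>0 \<and> (\<forall>v. norm ((S \<phi> - Sa \<phi>) *v v) \<le> \<epsilon>a * norm v)"
      using s\<^sub>0(2) SSa' by eventually_elim simp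
    from pick[OF that(2) this] obtain \<phi> where \<phi>: "\<phi> \<in> \<B> j" "mnorm (S \<phi>) \<le> s\<^sub>0"
      "norm ((S \<phi> - Sa \<phi>) *v v) \<le> \<epsilon>a * norm v" by blast
    have "T j *v v = S \<phi> *v v - (S \<phi> - Sa \<phi>) *v v"
      using that Sa[OF that(1) \<phi>(1)] by (simp add: T_def matrix_vector_mult_diff_rdistrib)
    also have "norm \<dots> \<le> mnorm (S \<phi>) * norm v + \<epsilon>a * norm v"
      by (intro order_trans[OF norm_triangle_ineq4] add_mono norm_le_mnorm \<phi>)
    also have "\<dots> \<le> s\<^sub>0 * norm v + 1 * norm v"
      by (intro add_mono mult_right_mono \<phi> \<open>\<epsilon>a \<le> 1\<close>) auto
    finally show ?thesis by (simp add: distrib_right)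
  qed
  have T_norm: "norm (T j *v v) \<le> s * norm v" if "j < N" for j v
  proof (cases "null j")
    case True
    then have "norm (T j *v v) = L * norm v"
      using \<open>L > 0\<close> by (simp add: T_def scaleR_matrix_vector_assoc[symmetric])
    then show ?thesis using s\<^sub>0(1) by (simp add: s_def distrib_right)
  next
    case False
    have "(s\<^sub>0 + 1) * norm v \<le> s * norm v"
      using \<open>L > 0\<close> by (intro mult_right_mono) (simp_all add: s_def)
    then show ?thesis using T_live[OF that False, of v] by simp
  qed
  have H_norm: "norm (H j *v v) \<le> f * norm v" if "j < N" for j v
  proof (cases "null j")
    case False
    have "AE \<phi> in \<mu>. \<phi> \<in> \<B> j \<longrightarrow> mnorm (F \<phi>) \<le> f\<^sub>0 \<and> (\<forall>v. norm ((F \<phi> - Fa \<phi>) *v v) \<le> \<epsilon>a * norm v)"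
      using f\<^sub>0(2) FFa' by eventually_elim simp
    from pick[OF False this] obtain \<phi> where \<phi>: "\<phi> \<in> \<B> j" "mnorm (F \<phi>) \<le> f\<^sub>0"
      "norm ((F \<phi> - Fa \<phi>) *v v) \<le> \<epsilon>a * norm v" by blast
    have "H j *v v = F \<phi> *v v - (F \<phi> - Fa \<phi>) *v v"
      using False Fa[OF that \<phi>(1)] by (simp add: H_def matrix_vector_mult_diff_rdistrib)
    also have "norm \<dots> \<le> mnorm (F \<phi>) * norm v + \<epsilon>a * norm v"
      by (intro order_trans[OF norm_triangle_ineq4] add_mono norm_le_mnorm \<phi>)
    also have "\<dots> \<le> f\<^sub>0 * norm v + 1 * norm v"
      by (intro add_mono mult_right_mono \<phi> \<open>\<epsilon>a \<le> 1\<close>) auto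
    finally show ?thesis by (simp add: f_def distrib_right)
  qed (use \<open>f \<ge> 0\<close> in \<open>simp add: H_def\<close>)

  have riccati: "\<eta> * (norm y)\<^sup>2 + (\<Sum>j<N. w j (c i) *
      ((A (c i) *v y + B (c i) *v (H i *v y)) \<bullet> (T j *v (A (c i) *v y + B (c i) *v (H i *v y)))))
      \<le> y \<bullet> (T i *v y)" if i: "i < N" for i y
  proof (cases "null i")
    case True
    define u where "u = A (c i) *v y"
    have "w j (c i) * (u \<bullet> (T j *v u)) \<le> w j (c i) * ((s\<^sub>0 + 1) * (norm u)\<^sup>2)" if "j < N" for j
    proof (cases "null j")
      case False
      then show ?thesis by (intro mult_left_mono quadratic_form_le T_live that w cM i)
    qed (simp add: w_null[OF _ cM[OF i]])
    then have "(\<Sum>j<N. w j (c i) * (u \<bullet> (T j *v u))) \<le> (\<Sum>j<N. w j (c i)) * ((s\<^sub>0 + 1) * (norm u)\<^sup>2)"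
      unfolding sum_distrib_right by (intro sum_mono) simp
    also have "\<dots> \<le> 1 * ((s\<^sub>0 + 1) * (a * norm y)\<^sup>2)"
      using s\<^sub>0(1) unfolding u_def by (intro mult_mono w cM i mult_left_mono power_mono a) auto
    also have "\<eta> * (norm y)\<^sup>2 + \<dots> \<le> L * (norm y)\<^sup>2"
      using \<open>\<epsilon> > 0\<close> by (simp add: L_def \<eta>_def power_mult_distrib algebra_simps)
    also have "\<dots> = y \<bullet> (T i *v y)"
      using True by (simp add: T_def scaleR_matrix_vector_assoc[symmetric] power2_norm_eq_inner)
    finally show ?thesis using True by (simp add: H_def u_def)
  next
    case False
    have "AE \<phi> in \<mu>. \<phi> \<in> \<B> i \<longrightarrow>
        psd (S \<phi> - transpose (A \<phi> + B \<phi> ** F \<phi>) ** (LINT y|\<mu>. g \<phi> y *\<^sub>R S y)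
          ** (A \<phi> + B \<phi> ** F \<phi>) - \<epsilon> *\<^sub>R mat 1) \<and>
        mnorm (F \<phi>) \<le> f\<^sub>0 \<and> (\<forall>v. norm ((F \<phi> - Fa \<phi>) *v v) \<le> \<epsilon>a * norm v) \<and>
        (\<forall>v. norm ((S \<phi> - Sa \<phi>) *v v) \<le> \<epsilon>a * norm v) \<and>
        mnorm (hcat (A \<phi>) (B \<phi>) - hcat (A (c i)) (B (c i))) < \<epsilon>b \<and>
        L2_set (\<lambda>j. sqrt (box_prob \<mu> g \<B> j \<phi>) - sqrt (box_prob \<mu> g \<B> j (c i))) {..<N} < \<epsilon>b"
      using ric f\<^sub>0(2) FFa' SSa' near[OF i] by eventually_elim simp
    from pick[OF False this] obtain \<phi> where \<phi>: "\<phi> \<in> \<B> i" "\<phi> \<in> M"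
        "psd (S \<phi> - transpose (A \<phi> + B \<phi> ** F \<phi>) ** (LINT y|\<mu>. g \<phi> y *\<^sub>R S y)
          ** (A \<phi> + B \<phi> ** F \<phi>) - \<epsilon> *\<^sub>R mat 1)"
      and F\<phi>: "mnorm (F \<phi>) \<le> f\<^sub>0" "\<And>v. norm ((F \<phi> - Fa \<phi>) *v v) \<le> \<epsilon>a * norm v"
      and S\<phi>: "\<And>v. norm ((S \<phi> - Sa \<phi>) *v v) \<le> \<epsilon>a * norm v"
      and AB: "mnorm (hcat (A \<phi>) (B \<phi>) - hcat (A (c i)) (B (c i))) < \<epsilon>b"
      and L2: "L2_set (\<lambda>j. sqrt (w j \<phi>) - sqrt (w j (c i))) {..<N} < \<epsilon>b"
      unfolding w_def by blast
    have AB': "mnorm (hcat (A \<phi> - A (c i)) (B \<phi> - B (c i))) \<le> \<epsilon>b"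
      using AB by (simp add: hcat_diff)
    show ?thesis
    proof (rule riccati_perturbation[OF \<phi>(3), where w' = "\<lambda>j. w j \<phi>" and e = \<epsilon>a and e' = \<epsilon>b
          and s = s and a = a and b = b and f = f])
      show "posdef (T j)" if "j < N" for j by (rule T_pd[OF that])
      show "norm (T j *v v) \<le> s * norm v" if "j < N" for j v by (rule T_norm[OF that])
      show "(\<Sum>j<N. w j \<phi> * (v \<bullet> (T j *v v)))
          \<le> v \<bullet> ((LINT y|\<mu>. g \<phi> y *\<^sub>R S y) *v v) + \<epsilon>a * (norm v)\<^sup>2" for v
        unfolding w_def
      proof (rule expectation_ge_step_function[OF g _ meas disj un SH])
        fix j assume j: "j < N"
        show "AE y in \<mu>. y \<in> \<B> j \<longrightarrow> v \<bullet> (T j *v v) \<le> v \<bullet> (S y *v v) + \<epsilon>a * (norm v)\<^sup>2"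
        proof (cases "null j")
          case True
          then show ?thesis unfolding null_def by eventually_elim simp
        next
          case False
          show ?thesis
            using SSa'
          proof eventually_elim
            case (elim y)
            show ?case
            proof
              assume "y \<in> \<B> j"
              then have "T j = Sa y" using False Sa[OF j] by (simp add: T_def)
              moreover have "norm ((Sa y - S y) *v v) \<le> \<epsilon>a * norm v"
                using elim by (simp add: matrix_vector_mult_diff_rdistrib norm_minus_commute)
              ultimately show "v \<bullet> (T j *v v) \<le> v \<bullet> (S y *v v) + \<epsilon>a * (norm v)\<^sup>2"
                using quadratic_form_le[of "Sa y - S y" v \<epsilon>a]
                by (simp add: matrix_vector_mult_diff_rdistrib inner_diff_right)
            qed
          qed
        qed
      qed (use \<phi>(2) space in auto)
      show "v \<bullet> (S \<phi> *v v) \<le> v \<bullet> (T i *v v) + \<epsilon>a * (norm v)\<^sup>2" for v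
        using quadratic_form_le[OF S\<phi>, of v] False Sa[OF i \<phi>(1)]
        by (simp add: T_def matrix_vector_mult_diff_rdistrib inner_diff_right)
      show "norm (F \<phi> *v v - H i *v v) \<le> \<epsilon>a * norm v" for v
        using F\<phi>(2)[of v] False Fa[OF i \<phi>(1)] by (simp add: H_def matrix_vector_mult_diff_rdistrib)
      show "norm (A \<phi> *v v - A (c i) *v v) \<le> \<epsilon>b * norm v" for v
        using block_norms_le_hcat(1)[OF AB', of v] by (simp add: matrix_vector_mult_diff_rdistrib)
      show "norm (B \<phi> *v v - B (c i) *v v) \<le> \<epsilon>b * norm v" for v
        using block_norms_le_hcat(2)[OF AB', of v] by (simp add: matrix_vector_mult_diff_rdistrib)
      show "(\<Sum>j<N. \<bar>w j (c i) - w j \<phi>\<bar>) \<le> 2 * \<epsilon>b"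
        using sum_abs_diff_le_L2_sqrt[of "{..<N}" "\<lambda>j. w j \<phi>" "\<lambda>j. w j (c i)"] w[OF \<phi>(2)] w[OF cM[OF i]] L2
        by (simp add: abs_minus_commute)
      show "norm (F \<phi> *v v) \<le> f * norm v" for v
      proof -
        have "mnorm (F \<phi>) * norm v \<le> f * norm v"
          using F\<phi>(1) by (intro mult_right_mono) (simp_all add: f_def)
        then show ?thesis using norm_le_mnorm[of "F \<phi>" v] by simp
      qed
      show "\<eta> + \<epsilon>a * (1 + (a + b * f)\<^sup>2 + 2 * s * (a + b * f) * b)
          + \<epsilon>b * (2 * s * (a + b * f)\<^sup>2 + 2 * s * (a + b * f) * (1 + f)) \<le> \<epsilon>"
        using small by (simp add: p_def q_def k_def)
    qed (use w cM[OF i] a b \<phi>(2) H_norm[OF i] \<open>s > 0\<close> \<open>f \<ge> 0\<close> \<open>\<epsilon>a > 0\<close> \<open>\<epsilon>b > 0\<close> in auto)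
  qed

  have stacked: "AE \<phi> in \<mu>. \<phi> \<in> \<B> i \<longrightarrow>
      stacked_mnorm N (\<lambda>j. hcat (sqrt (w j \<phi>) *\<^sub>R A \<phi>) (sqrt (w j \<phi>) *\<^sub>R B \<phi>)
        - hcat (sqrt (w j (c i)) *\<^sub>R A (c i)) (sqrt (w j (c i)) *\<^sub>R B (c i))) \<le> \<epsilon>b * C"
    if i: "i < N" for i
    using near[OF i]
  proof eventually_elim
    case (elim \<phi>)
    show ?case
    proof
      assume "\<phi> \<in> \<B> i"
      with elim have AB: "mnorm (hcat (A \<phi>) (B \<phi>) - hcat (A (c i)) (B (c i))) < \<epsilon>b"
        and L2: "L2_set (\<lambda>j. sqrt (w j \<phi>) - sqrt (w j (c i))) {..<N} < \<epsilon>b"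
        unfolding w_def by auto
      have \<phi>: "\<phi> \<in> M" using BM[OF i] \<open>\<phi> \<in> \<B> i\<close> by blast
      show "stacked_mnorm N (\<lambda>j. hcat (sqrt (w j \<phi>) *\<^sub>R A \<phi>) (sqrt (w j \<phi>) *\<^sub>R B \<phi>)
        - hcat (sqrt (w j (c i)) *\<^sub>R A (c i)) (sqrt (w j (c i)) *\<^sub>R B (c i))) \<le> \<epsilon>b * C"
        unfolding hcat_scaleR C_def
      proof (rule stacked_mnorm_weighted_le)
        show "norm ((hcat (A \<phi>) (B \<phi>) - hcat (A (c i)) (B (c i))) *v x) \<le> \<epsilon>b * norm x" for x
          using norm_le_mnorm[of "hcat (A \<phi>) (B \<phi>) - hcat (A (c i)) (B (c i))" x]
            mult_right_mono[OF less_imp_le[OF AB], of "norm x"] by simp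
        show "norm (hcat (A (c i)) (B (c i)) *v x) \<le> (a + b) * norm x" for x
          by (intro hcat_mult_le a b cM i)
      qed (use w[OF \<phi>] L2 \<open>\<epsilon>b > 0\<close> a(1) b(1) in auto)
    qed
  qed

  have lmi: "posdef_on (lmi_indices N) (lmi_matrix i (\<lambda>j. sqrt (w j (c i)) *\<^sub>R A (c i))
      (\<lambda>j. sqrt (w j (c i)) *\<^sub>R B (c i)) (\<epsilon>b * C) (\<lambda>j. matrix_inv (T j)) (matrix_inv (T i))
      (H i ** matrix_inv (T i)) l)" if i: "i < N" for i
    by (rule riccati_imp_lmi[OF i \<open>s > 0\<close> \<open>\<eta> > 0\<close>, where f = f])
      (use T_pd quadratic_form_le[OF T_norm] w(1)[OF cM[OF i]] riccati[OF i] H_norm[OF i] \<kappa> in \<open>auto simp: l_def\<close>)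
  show ?thesis
  proof (intro exI conjI allI impI)
    show "box_partition M N \<B>" by (rule part)
    show "c i \<in> \<B> i" if "i < N" for i by (rule c[OF that])
    show "0 < \<epsilon>b * C" for i :: nat using \<open>\<epsilon>b > 0\<close> \<open>C > 0\<close> by simp
    show "AE \<phi> in \<mu>. \<phi> \<in> \<B> i \<longrightarrow>
      stacked_mnorm N (\<lambda>j. hcat (sqrt (box_prob \<mu> g \<B> j \<phi>) *\<^sub>R A \<phi>) (sqrt (box_prob \<mu> g \<B> j \<phi>) *\<^sub>R B \<phi>)
        - hcat (sqrt (box_prob \<mu> g \<B> j (c i)) *\<^sub>R A (c i)) (sqrt (box_prob \<mu> g \<B> j (c i)) *\<^sub>R B (c i)))
      \<le> \<epsilon>b * C" if "i < N" for i
      using stacked[OF that] by (simp add: w_def)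
    show "posdef (matrix_inv (T i))" if "i < N" for i by (rule posdef_matrix_inv[OF T_pd[OF that]])
    show "0 < l" for i :: nat by (rule \<open>l > 0\<close>)
    show "posdef_on (lmi_indices N) (lmi_matrix i (\<lambda>j. sqrt (box_prob \<mu> g \<B> j (c i)) *\<^sub>R A (c i))
      (\<lambda>j. sqrt (box_prob \<mu> g \<B> j (c i)) *\<^sub>R B (c i)) (\<epsilon>b * C) (\<lambda>j. matrix_inv (T j)) (matrix_inv (T i))
      (H i ** matrix_inv (T i)) l)" if "i < N" for i
      using lmi[OF that] by (simp add: w_def)
  qed simp_all
qed

end
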